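(* Let $X$ be an infinite connected graph with bounded degree which is Gromov hyperbolic. Suppose that for every bounded set $B$, at least one connected component of $X\setminus B$ is not a tree. Let $\nu$ be a probability measure on $[0,\infty)$ with finite expectation ($\mathbb{E}\,\omega_e<\infty$), $\operatorname{Supp}(\nu)=(0,\infty)$ and $\nu(\{0\})=0$. Then there exists a subset $\Omega_1\subset\Omega$ of full $\mathbb{P}$-measure such that for all $\omega\in\Omega_1$, the metric realization $X_\omega$ is not Gromov hyperbolic.
   Context: Graphs are undirected and simple, with vertex set $V$ and edge set $E$; $d$ is the graph metric (all edges of length $1$). First-passage percolation: $\Omega=[0,\infty)^E$ with the product measure $\mathbb{P}=\nu^{\otimes E}$; for $\omega\in\Omega$, $\omega(e)=\omega_e$ is the length of the edge $e$ (so the $\omega_e$ are i.i.d. with law $\nu$). For a finite edge path $\gamma$, $|\gamma|_\omega=\sum_{e\in\gamma}\omega(e)$, and $d_\omega(x,y)=\inf_\gamma|\gamma|_\omega$ over all edge paths $\gamma$ from $x$ to $y$. $X_\omega$ denotes the metric realization: each edge $e=(v_1,v_2)$ is replaced by an interval of length $\omega(e)$ whose endpoints are glued to $v_1,v_2$, with the induced path metric $d_\omega$. $\operatorname{Supp}(\nu)=(0,\infty)$ means that $\nu$ is carried by $(0,\infty)$ and every nonempty open subinterval of $(0,\infty)$ has positive $\nu$-measure. A geodesic triangle in a geodesic metric space is $\delta$-slim if each side is contained in the $\delta$-neighborhood of the union of the other two sides. A geodesic metric space is $\delta$-hyperbolic if every geodesic triangle in it is $\delta$-slim, and (Gromov)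 hyperbolic if it is $\delta$-hyperbolic for some $\delta\ge 0$. *)

theory Defs
  imports "HOL-Probability.Probability"
begin

text \<open>A graph is a vertex set \<open>V\<close> together with a set \<open>E\<close> of unordered edges \<open>{u, v}\<close>;
  an edge is identified with the set of its two endpoints.\<close>

definition simple_graph :: "'a set \<Rightarrow> 'a set set \<Rightarrow> bool" where
  "simple_graph V E \<longleftrightarrow> (\<forall>e\<in>E. \<exists>u\<in>V. \<exists>v\<in>V. u \<noteq> v \<and> e = {u, v})"

definition bounded_degree :: "'a set \<Rightarrow> 'a set set \<Rightarrow> bool" where
  "bounded_degree V E \<longleftrightarrow>
     (\<exists>D::nat. \<forall>v\<in>V. finite {e \<in> E. v \<in> e} \<and> card {e \<in> E. v \<in> e} \<le> D)"

definition edge_path :: "'a set \<Rightarrow> 'a set set \<Rightarrow> 'a \<Rightarrow> 'a \<Rightarrow> 'a list \<Rightarrow> bool" where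
  "edge_path V E x y xs \<longleftrightarrow> xs \<noteq> [] \<and> set xs \<subseteq> V \<and> hd xs = x \<and> last xs = y \<and>
     successively (\<lambda>u v. {u, v} \<in> E) xs"

definition connected_graph :: "'a set \<Rightarrow> 'a set set \<Rightarrow> bool" where
  "connected_graph V E \<longleftrightarrow> V \<noteq> {} \<and> (\<forall>x\<in>V. \<forall>y\<in>V. \<exists>xs. edge_path V E x y xs)"

definition is_cycle :: "'a set \<Rightarrow> 'a set set \<Rightarrow> 'a list \<Rightarrow> bool" where
  "is_cycle V E xs \<longleftrightarrow> 3 \<le> length xs \<and> distinct xs \<and> set xs \<subseteq> V \<and>
     successively (\<lambda>u v. {u, v} \<in> E) xs \<and> {last xs, hd xs} \<in> E"

definition is_tree :: "'a set \<Rightarrow> 'a set set \<Rightarrow> bool" where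
  "is_tree V E \<longleftrightarrow> connected_graph V E \<and> (\<nexists>xs. is_cycle V E xs)"

definition induced_edges :: "'a set set \<Rightarrow> 'a set \<Rightarrow> 'a set set" where
  "induced_edges E W = {e \<in> E. e \<subseteq> W}"

definition graph_components :: "'a set \<Rightarrow> 'a set set \<Rightarrow> 'a set set" where
  "graph_components V E = {{y. \<exists>xs. edge_path V E x y xs} | x. x \<in> V}"

definition path_length :: "('a set \<Rightarrow> real) \<Rightarrow> 'a list \<Rightarrow> real" where
  "path_length \<omega> xs = (\<Sum>(u, v)\<leftarrow>zip xs (tl xs). \<omega> {u, v})"

definition vertex_dist :: "'a set \<Rightarrow> 'a set set \<Rightarrow> ('a set \<Rightarrow> real) \<Rightarrow> 'a \<Rightarrow> 'a \<Rightarrow> real" where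
  "vertex_dist V E \<omega> x y = Inf {path_length \<omega> xs | xs. edge_path V E x y xs}"

definition bounded_vertex_set :: "'a set \<Rightarrow> 'a set set \<Rightarrow> 'a set \<Rightarrow> bool" where
  "bounded_vertex_set V E B \<longleftrightarrow>
     B \<subseteq> V \<and> (\<exists>r. \<forall>x\<in>B. \<forall>y\<in>B. vertex_dist V E (\<lambda>_. 1) x y \<le> r)"

text \<open>Points of the realization are given by barycentric coordinates: on the edge \<open>e = {u, v}\<close>
  the function \<open>p\<close> with \<open>p u = 1 - s\<close>, \<open>p v = s\<close> is the point at distance \<open>s * \<omega> e\<close> from \<open>u\<close>
  along \<open>e\<close>; the vertex \<open>v\<close> is the function that is 1 at \<open>v\<close> and 0 elsewhere. Hence endpoints of
  different edges are glued automatically and the point set does not depend on \<open>\<omega>\<close>. If some edge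
  has length 0, the distance below is only a pseudometric on this set.\<close>

definition cell_points :: "'a set \<Rightarrow> ('a \<Rightarrow> real) set" where
  "cell_points e = {p. (\<forall>x. 0 \<le> p x) \<and> (\<forall>x. x \<notin> e \<longrightarrow> p x = 0) \<and> (\<Sum>x\<in>e. p x) = 1}"

definition realization :: "'a set \<Rightarrow> 'a set set \<Rightarrow> ('a \<Rightarrow> real) set" where
  "realization V E = (\<Union>v\<in>V. cell_points {v}) \<union> (\<Union>e\<in>E. cell_points e)"

text \<open>Length of the subinterval of \<open>e\<close> between \<open>p\<close> and \<open>q\<close>. For \<open>e = {u, v}\<close> both summands
  \<open>\<bar>p u - q u\<bar>\<close> and \<open>\<bar>p v - q v\<bar>\<close> are equal, which explains the factor 1/2.\<close>

definition subedge_length :: "('a set \<Rightarrow> real) \<Rightarrow> 'a set \<Rightarrow> ('a \<Rightarrow> real) \<Rightarrow> ('a \<Rightarrow> real) \<Rightarrow> real" where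
  "subedge_length \<omega> e p q = \<omega> e * (\<Sum>x\<in>e. \<bar>p x - q x\<bar>) / 2"

text \<open>\<open>pl_path V E \<omega> p q l\<close>: some piecewise linear path from \<open>p\<close> to \<open>q\<close> in the realization, each
  piece of which runs linearly inside one closed edge, has length \<open>l\<close>.\<close>

inductive pl_path ::
  "'a set \<Rightarrow> 'a set set \<Rightarrow> ('a set \<Rightarrow> real) \<Rightarrow> ('a \<Rightarrow> real) \<Rightarrow> ('a \<Rightarrow> real) \<Rightarrow> real \<Rightarrow> bool"
  for V :: "'a set" and E :: "'a set set" and \<omega> :: "'a set \<Rightarrow> real" where
  pl_refl: "p \<in> realization V E \<Longrightarrow> pl_path V E \<omega> p p 0"
| pl_step: "pl_path V E \<omega> p q l \<Longrightarrow> e \<in> E \<Longrightarrow> q \<in> cell_points e \<Longrightarrow> r \<in> cell_points e \<Longrightarrow>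
    pl_path V E \<omega> p r (l + subedge_length \<omega> e q r)"

definition realization_dist ::
  "'a set \<Rightarrow> 'a set set \<Rightarrow> ('a set \<Rightarrow> real) \<Rightarrow> ('a \<Rightarrow> real) \<Rightarrow> ('a \<Rightarrow> real) \<Rightarrow> real" where
  "realization_dist V E \<omega> p q = Inf {l. pl_path V E \<omega> p q l}"

text \<open>The notions below are formulated for a set \<open>M\<close> with an arbitrary distance function \<open>d\<close>, since
  \<open>realization_dist\<close> need not be a metric for exceptional \<open>\<omega>\<close>. Existence of geodesics is not built
  into \<open>gromov_hyperbolic\<close>, so failure of hyperbolicity always means that for every \<open>\<delta>\<close> there is
  a geodesic triangle that is not \<open>\<delta>\<close>-slim.\<close>

definition geodesic_segment ::
  "'p set \<Rightarrow> ('p \<Rightarrow> 'p \<Rightarrow> real) \<Rightarrow> 'p \<Rightarrow> 'p \<Rightarrow> 'p set \<Rightarrow> bool" where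
  "geodesic_segment M d x y S \<longleftrightarrow>
     (\<exists>L (g::real \<Rightarrow> 'p). 0 \<le> L \<and> g 0 = x \<and> g L = y \<and> g ` {0..L} = S \<and> S \<subseteq> M \<and>
        (\<forall>s\<in>{0..L}. \<forall>t\<in>{0..L}. d (g s) (g t) = \<bar>s - t\<bar>))"

definition geodesic_triangle ::
  "'p set \<Rightarrow> ('p \<Rightarrow> 'p \<Rightarrow> real) \<Rightarrow> 'p set \<Rightarrow> 'p set \<Rightarrow> 'p set \<Rightarrow> bool" where
  "geodesic_triangle M d S1 S2 S3 \<longleftrightarrow>
     (\<exists>x\<in>M. \<exists>y\<in>M. \<exists>z\<in>M.
        geodesic_segment M d x y S1 \<and> geodesic_segment M d y z S2 \<and> geodesic_segment M d z x S3)"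

definition neighborhood_of ::
  "'p set \<Rightarrow> ('p \<Rightarrow> 'p \<Rightarrow> real) \<Rightarrow> real \<Rightarrow> 'p set \<Rightarrow> 'p set" where
  "neighborhood_of M d \<delta> A = {p \<in> M. \<exists>q\<in>A. d p q \<le> \<delta>}"

definition slim_triangle ::
  "'p set \<Rightarrow> ('p \<Rightarrow> 'p \<Rightarrow> real) \<Rightarrow> real \<Rightarrow> 'p set \<Rightarrow> 'p set \<Rightarrow> 'p set \<Rightarrow> bool" where
  "slim_triangle M d \<delta> S1 S2 S3 \<longleftrightarrow>
     S1 \<subseteq> neighborhood_of M d \<delta> (S2 \<union> S3) \<and>
     S2 \<subseteq> neighborhood_of M d \<delta> (S1 \<union> S3) \<and>
     S3 \<subseteq> neighborhood_of M d \<delta> (S1 \<union> S2)"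

definition delta_hyperbolic :: "'p set \<Rightarrow> ('p \<Rightarrow> 'p \<Rightarrow> real) \<Rightarrow> real \<Rightarrow> bool" where
  "delta_hyperbolic M d \<delta> \<longleftrightarrow>
     (\<forall>S1 S2 S3. geodesic_triangle M d S1 S2 S3 \<longrightarrow> slim_triangle M d \<delta> S1 S2 S3)"

definition gromov_hyperbolic :: "'p set \<Rightarrow> ('p \<Rightarrow> 'p \<Rightarrow> real) \<Rightarrow> bool" where
  "gromov_hyperbolic M d \<longleftrightarrow> (\<exists>\<delta>\<ge>0. delta_hyperbolic M d \<delta>)"

definition support_is_positive_reals :: "real measure \<Rightarrow> bool" where
  "support_is_positive_reals \<nu> \<longleftrightarrow>
     emeasure \<nu> (space \<nu> - {0<..}) = 0 \<and>
     (\<forall>a b. 0 \<le> a \<longrightarrow> a < b \<longrightarrow> 0 < emeasure \<nu> {a<..<b})"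

end

(*
  Lower bounds for the metric of the realization come from 1-Lipschitz functions, which in turn come
  from functions on the vertices that change along an edge by at most its weight.

  In the unweighted graph, take a long cycle and a vertex x of it that is farthest from a base
  point. If the arc of length 2m around x (with m > 2 delta) were geodesic, the slim triangle over
  it would bring x closer to the base point than one of the ends of the arc. So the arc has a
  shortcut, and a minimal shortcut closes up to a cycle of length at most 4m. Hence every
  bounded set is avoided by a cycle of bounded length, and there are infinitely many such cycles
  with pairwise disjoint sets of incident edges.

  For every L, with a probability bounded below, the weights on the edges meeting such a cycle turn
  it into an isometrically embedded triangle whose sides have lengths between 2L and 3L and one of
  whose sides is a single edge; the midpoint of this edge is farther than L from the other sides.
  By independence this almost surely happens for some cycle, for all natural numbers L at once.
*)

theory Submission
  imports Defs
begin

section \<open>The metric of the realization\<close>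

abbreviation vertex_point :: "'a \<Rightarrow> 'a \<Rightarrow> real" where
  "vertex_point v \<equiv> indicator {v}"

lemma cell_points_singleton [simp]: "cell_points {v} = {vertex_point v}"
  by (auto simp: cell_points_def indicator_def fun_eq_iff)

lemma vertex_point_in_cell [simp]:
  assumes "finite e" "v \<in> e"
  shows "vertex_point v \<in> cell_points e"
  using assms by (auto simp: cell_points_def indicator_def)

lemma vertex_point_in_pair [simp]:
  "vertex_point u \<in> cell_points {u, v}" "vertex_point v \<in> cell_points {u, v}"
  by simp_all

lemma cell_points_pairD:
  assumes "u \<noteq> v" "p \<in> cell_points {u, v}"
  shows "0 \<le> p u" "0 \<le> p v" "p u + p v = 1" "\<And>x. x \<noteq> u \<Longrightarrow> x \<noteq> v \<Longrightarrow> p x = 0"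
  using assms by (auto simp: cell_points_def)

lemma cell_points_outside: "p \<in> cell_points e \<Longrightarrow> x \<notin> e \<Longrightarrow> p x = 0"
  by (auto simp: cell_points_def)

lemma subedge_length_pair:
  assumes "u \<noteq> v" "p \<in> cell_points {u, v}" "q \<in> cell_points {u, v}"
  shows "subedge_length \<omega> {u, v} p q = \<omega> {u, v} * \<bar>p u - q u\<bar>"
proof -
  have "p v - q v = - (p u - q u)"
    using cell_points_pairD(3)[OF assms(1,2)] cell_points_pairD(3)[OF assms(1,3)] by simp
  then have "\<bar>p v - q v\<bar> = \<bar>p u - q u\<bar>" by simp
  with assms(1) show ?thesis by (simp add: subedge_length_def)
qed

lemma subedge_length_commute: "subedge_length \<omega> e p q = subedge_length \<omega> e q p"
  by (simp add: subedge_length_def abs_minus_commute)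

section \<open>Piecewise linear paths\<close>

lemma pl_path_trans:
  assumes "pl_path V E \<omega> q r m" "pl_path V E \<omega> p q l"
  shows "pl_path V E \<omega> p r (l + m)"
  using assms
proof induction
  case (pl_step q r m e s)
  then show ?case
    using pl_path.pl_step[of V E \<omega> p r "l + m" e s] by (simp add: add.assoc)
qed simp

lemma pl_path_single:
  assumes "e \<in> E" "p \<in> cell_points e" "q \<in> cell_points e"
  shows "pl_path V E \<omega> p q (subedge_length \<omega> e p q)"
proof -
  have "p \<in> realization V E" using assms by (auto simp: realization_def)
  from pl_step[OF pl_refl[OF this] assms] show ?thesis by simp
qed

lemma pl_path_sym: "pl_path V E \<omega> p q l \<Longrightarrow> pl_path V E \<omega> q p l"
proof (induction rule: pl_path.induct)
  case (pl_refl p)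
  then show ?case by (rule pl_path.pl_refl)
next
  case (pl_step p q l e r)
  have "pl_path V E \<omega> r q (subedge_length \<omega> e r q)"
    using pl_step by (intro pl_path_single) auto
  from pl_path_trans[OF pl_step.IH this] show ?case
    by (simp add: add.commute subedge_length_commute)
qed

text \<open>The bounds on the pieces add up along the path. Every lower bound on distances below
  comes from a function \<open>\<phi>\<close> that is 1-Lipschitz on each closed edge.\<close>

lemma pl_path_lipschitz:
  fixes \<phi> :: "('a \<Rightarrow> real) \<Rightarrow> real"
  assumes "pl_path V E \<omega> p q l"
    and "\<And>e p q. e \<in> E \<Longrightarrow> p \<in> cell_points e \<Longrightarrow> q \<in> cell_points e \<Longrightarrow>
           \<bar>\<phi> p - \<phi> q\<bar> \<le> subedge_length \<omega> e p q"
  shows "\<bar>\<phi> p - \<phi> q\<bar> \<le> l"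
  using assms(1)
proof induction
  case (pl_step p q l e r)
  then show ?case using assms(2)[of e q r] by linarith
qed simp

section \<open>Edge paths and their traces in the realization\<close>

lemma edge_path_append:
  assumes "edge_path V E x y xs" "edge_path V E y z ys"
  shows "edge_path V E x z (xs @ tl ys)"
proof (cases ys)
  case (Cons a as)
  then show ?thesis using assms
    by (cases as) (auto simp: edge_path_def successively_append_iff last_append)
qed (use assms in \<open>auto simp: edge_path_def\<close>)

lemma edge_path_rev: "edge_path V E x y xs \<Longrightarrow> edge_path V E y x (rev xs)"
  by (auto simp: edge_path_def hd_rev last_rev insert_commute)

text \<open>The set \<open>cell_points {hd xs}\<close> gives a path with a single vertex its one
  point; a longer path has this point on its first edge anyway.\<close>

definition path_points :: "'a list \<Rightarrow> ('a \<Rightarrow> real) set" where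
  "path_points xs = cell_points {hd xs} \<union> (\<Union>(u, v)\<in>set (zip xs (tl xs)). cell_points {u, v})"

lemma path_points_Cons_Cons [simp]:
  "path_points (a # b # xs) = cell_points {a, b} \<union> path_points (b # xs)"
  by (auto simp: path_points_def)

lemma path_points_Nil_Cons [simp]: "path_points [a] = {vertex_point a}"
  by (auto simp: path_points_def)

lemma path_points_outside:
  assumes "xs \<noteq> []" "p \<in> path_points xs" "x \<notin> set xs"
  shows "p x = 0"
  using assms
  by (induction xs rule: induct_list012) (auto dest: cell_points_outside)

lemma vertex_point_in_path_points: "x \<in> set xs \<Longrightarrow> vertex_point x \<in> path_points xs"
  by (induction xs rule: induct_list012) auto

lemma path_length_Cons_Cons [simp]:
  "path_length \<omega> (a # b # xs) = \<omega> {a, b} + path_length \<omega> (b # xs)"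
  by (simp add: path_length_def)

lemma path_length_Nil_Cons [simp]: "path_length \<omega> [a] = 0" "path_length \<omega> [] = 0"
  by (simp_all add: path_length_def)

lemma path_length_conv_nth:
  "path_length \<omega> xs = (\<Sum>i<length xs - 1. \<omega> {xs ! i, xs ! Suc i})"
proof (induction xs rule: induct_list012)
  case (3 a b xs)
  then show ?case by (simp add: sum.lessThan_Suc_shift del: sum.lessThan_Suc)
qed simp_all

section \<open>The pseudometric of nonnegative edge weights\<close>

locale weighted_graph =
  fixes V :: "'a set" and E :: "'a set set" and \<omega> :: "'a set \<Rightarrow> real"
  assumes simple: "simple_graph V E"
    and connected: "connected_graph V E"
    and weight_nonneg: "e \<in> E \<Longrightarrow> 0 \<le> \<omega> e"
begin

abbreviation "X \<equiv> realization V E"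
abbreviation "d \<equiv> realization_dist V E \<omega>"

lemma edgeE:
  assumes "e \<in> E"
  obtains u v where "u \<in> V" "v \<in> V" "u \<noteq> v" "e = {u, v}"
  using simple assms by (auto simp: simple_graph_def)

lemma edge_distinct: "{u, v} \<in> E \<Longrightarrow> u \<noteq> v"
  by (erule edgeE) (auto simp: doubleton_eq_iff)

lemma edge_vertices: "{u, v} \<in> E \<Longrightarrow> u \<in> V" "{u, v} \<in> E \<Longrightarrow> v \<in> V"
  by (erule edgeE, auto simp: doubleton_eq_iff)+

lemma vertex_point_in_X [simp]: "v \<in> V \<Longrightarrow> vertex_point v \<in> X"
  by (auto simp: realization_def)

lemma cell_points_subset_X: "e \<in> E \<Longrightarrow> cell_points e \<subseteq> X"
  by (auto simp: realization_def)

lemma subedge_length_nonneg: "e \<in> E \<Longrightarrow> 0 \<le> subedge_length \<omega> e p q"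
  by (auto simp: subedge_length_def weight_nonneg sum_nonneg)

lemma pl_path_nonneg: "pl_path V E \<omega> p q l \<Longrightarrow> 0 \<le> l"
  by (induction rule: pl_path.induct) (auto simp: subedge_length_nonneg)

lemma pl_path_to_vertex:
  assumes "p \<in> X"
  shows "\<exists>v\<in>V. \<exists>l. pl_path V E \<omega> p (vertex_point v) l"
proof -
  consider v where "v \<in> V" "p = vertex_point v" | e where "e \<in> E" "p \<in> cell_points e"
    using assms by (auto simp: realization_def)
  then show ?thesis
  proof cases
    case 1
    then have "pl_path V E \<omega> p (vertex_point v) 0"
      by (auto intro!: pl_refl simp: realization_def)
    with 1 show ?thesis by blast
  next
    case 2
    then obtain u v where uv: "u \<in> V" "v \<in> V" "e = {u, v}" by (auto elim: edgeE)
    then show ?thesis using pl_path_single[of e E p "vertex_point u" V \<omega>] 2 by auto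
  qed
qed

lemma pl_path_vertices:
  assumes "edge_path V E x y xs"
  shows "\<exists>l. pl_path V E \<omega> (vertex_point x) (vertex_point y) l"
  using assms
proof (induction xs arbitrary: x rule: induct_list012)
  case (2 a)
  then show ?case by (auto simp: edge_path_def intro!: pl_refl exI[of _ 0])
next
  case (3 a b xs)
  then have "edge_path V E b y (b # xs)" "{a, b} \<in> E" "x = a" by (auto simp: edge_path_def)
  with 3(2) obtain l where "pl_path V E \<omega> (vertex_point b) (vertex_point y) l" by blast
  moreover have "pl_path V E \<omega> (vertex_point a) (vertex_point b)
      (subedge_length \<omega> {a, b} (vertex_point a) (vertex_point b))"
    using \<open>{a, b} \<in> E\<close> by (intro pl_path_single) auto
  ultimately show ?case using pl_path_trans \<open>x = a\<close> by blast
qed (auto simp: edge_path_def)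

lemma pl_path_exists:
  assumes "p \<in> X" "q \<in> X"
  shows "\<exists>l. pl_path V E \<omega> p q l"
proof -
  obtain u l where u: "u \<in> V" "pl_path V E \<omega> p (vertex_point u) l"
    using pl_path_to_vertex assms by blast
  obtain v m where v: "v \<in> V" "pl_path V E \<omega> q (vertex_point v) m"
    using pl_path_to_vertex assms by blast
  obtain xs where "edge_path V E u v xs"
    using connected u v by (auto simp: connected_graph_def)
  from pl_path_vertices[OF this] obtain n
    where "pl_path V E \<omega> (vertex_point u) (vertex_point v) n" ..
  with u v show ?thesis by (meson pl_path_trans pl_path_sym)
qed

lemma dist_le: "pl_path V E \<omega> p q l \<Longrightarrow> d p q \<le> l"
  unfolding realization_dist_def
  by (rule cInf_lower) (auto intro!: bdd_belowI[of _ 0] dest: pl_path_nonneg)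

text \<open>Connectedness makes the set of path lengths nonempty, so that a lower bound for all of
  them passes to the infimum.\<close>

lemma le_dist:
  assumes "p \<in> X" "q \<in> X" "\<And>l. pl_path V E \<omega> p q l \<Longrightarrow> c \<le> l"
  shows "c \<le> d p q"
  unfolding realization_dist_def
  using pl_path_exists[OF assms(1,2)] assms(3) by (intro cInf_greatest) auto

lemma dist_triangle:
  assumes "p \<in> X" "q \<in> X" "r \<in> X"
  shows "d p r \<le> d p q + d q r"
proof -
  \<comment> \<open>The infimum is taken twice: over the paths from \<open>q\<close> to
    \<open>r\<close> with the first path fixed, then over the first path.\<close>
  have "d p r - l \<le> d q r" if "pl_path V E \<omega> p q l" for l
    by (rule le_dist[OF assms(2,3)]) (use dist_le[OF pl_path_trans[OF _ that]] in force)
  then have "d p r - d q r \<le> d p q"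
    by (intro le_dist[OF assms(1,2)]) force
  then show ?thesis by simp
qed

lemma dist_commute: "d p q = d q p"
  unfolding realization_dist_def by (rule arg_cong[of _ _ Inf]) (auto intro: pl_path_sym)

lemma dist_self: "p \<in> X \<Longrightarrow> d p p \<le> 0"
  by (rule dist_le) (rule pl_refl)

lemma lipschitz_le_dist:
  fixes \<phi> :: "('a \<Rightarrow> real) \<Rightarrow> real"
  assumes "p \<in> X" "q \<in> X"
    and "\<And>e p q. e \<in> E \<Longrightarrow> p \<in> cell_points e \<Longrightarrow> q \<in> cell_points e \<Longrightarrow>
           \<bar>\<phi> p - \<phi> q\<bar> \<le> subedge_length \<omega> e p q"
  shows "\<bar>\<phi> p - \<phi> q\<bar> \<le> d p q"
  using assms(1,2) by (rule le_dist) (rule pl_path_lipschitz[OF _ assms(3)])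

text \<open>A potential on the vertices is extended linearly over the edges.\<close>

lemma potential_le_dist:
  fixes D :: "'a \<Rightarrow> real"
  assumes "x \<in> V" "y \<in> V" and D: "\<And>u v. {u, v} \<in> E \<Longrightarrow> \<bar>D u - D v\<bar> \<le> \<omega> {u, v}"
  shows "\<bar>D x - D y\<bar> \<le> d (vertex_point x) (vertex_point y)"
proof -
  define \<phi> :: "('a \<Rightarrow> real) \<Rightarrow> real" where "\<phi> p = (\<Sum>a | p a \<noteq> 0. p a * D a)" for p
  have vp: "\<phi> (vertex_point v) = D v" for v
  proof -
    have "{a. vertex_point v a \<noteq> (0::real)} = {v}" by (auto simp: indicator_def)
    then show ?thesis by (simp add: \<phi>_def)
  qed
  have "\<bar>\<phi> (vertex_point x) - \<phi> (vertex_point y)\<bar> \<le> d (vertex_point x) (vertex_point y)"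
  proof (rule lipschitz_le_dist)
    fix e p q assume e: "e \<in> E" "p \<in> cell_points e" "q \<in> cell_points e"
    then obtain u v where uv: "u \<noteq> v" "e = {u, v}" by (auto elim: edgeE)
    have eq: "\<phi> r = r u * D u + (1 - r u) * D v" if "r \<in> cell_points e" for r
    proof -
      have r: "r v = 1 - r u" "{a. r a \<noteq> 0} \<subseteq> {u, v}"
        using cell_points_pairD[of u v r] that uv by auto
      have "\<phi> r = (\<Sum>a\<in>{u, v}. r a * D a)"
        unfolding \<phi>_def using r by (intro sum.mono_neutral_left) auto
      with uv r show ?thesis by simp
    qed
    have "\<phi> p - \<phi> q = (p u - q u) * (D u - D v)" by (simp add: eq e algebra_simps)
    then have "\<bar>\<phi> p - \<phi> q\<bar> = \<bar>p u - q u\<bar> * \<bar>D u - D v\<bar>" by (simp add: abs_mult)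
    also have "\<dots> \<le> \<bar>p u - q u\<bar> * \<omega> {u, v}"
      using D[of u v] e uv by (intro mult_left_mono) auto
    finally show "\<bar>\<phi> p - \<phi> q\<bar> \<le> subedge_length \<omega> e p q"
      using subedge_length_pair[OF uv(1)] e uv by (simp add: mult.commute)
  qed (use assms in auto)
  then show ?thesis by (simp add: vp)
qed

text \<open>Up to the factor \<open>\<omega> {u, v}\<close>, \<open>min (p u) (p v)\<close> is the distance from \<open>p\<close> to the
  endpoints of \<open>{u, v}\<close> inside this edge, and it vanishes off the open edge.\<close>

lemma open_edge_dist:
  assumes uv: "{u, v} \<in> E" and "p \<in> X" "q \<in> X" "q u = 0 \<or> q v = 0" "0 \<le> q u" "0 \<le> q v"
  shows "\<omega> {u, v} * min (p u) (p v) \<le> d p q"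
proof -
  define \<phi> :: "('a \<Rightarrow> real) \<Rightarrow> real" where "\<phi> p = \<omega> {u, v} * min (p u) (p v)" for p
  have "u \<noteq> v" using uv by (rule edge_distinct)
  have "\<bar>\<phi> p - \<phi> q\<bar> \<le> d p q"
  proof (rule lipschitz_le_dist)
    fix e p q assume e: "e \<in> E" "p \<in> cell_points e" "q \<in> cell_points e"
    show "\<bar>\<phi> p - \<phi> q\<bar> \<le> subedge_length \<omega> e p q"
    proof (cases "e = {u, v}")
      case True
      \<comment> \<open>The two coordinates add up to 1, and \<open>min t (1 - t)\<close> is
        1-Lipschitz in \<open>t\<close>.\<close>
      have "\<bar>min (p u) (p v) - min (q u) (q v)\<bar> \<le> \<bar>p u - q u\<bar>"
        using cell_points_pairD(3)[OF \<open>u \<noteq> v\<close>] e True by (smt (verit))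
      then have "\<omega> {u, v} * \<bar>min (p u) (p v) - min (q u) (q v)\<bar> \<le> \<omega> {u, v} * \<bar>p u - q u\<bar>"
        using weight_nonneg[OF uv] by (rule mult_left_mono)
      moreover have "\<bar>\<phi> p - \<phi> q\<bar> = \<omega> {u, v} * \<bar>min (p u) (p v) - min (q u) (q v)\<bar>"
        using weight_nonneg[OF uv]
        by (simp add: \<phi>_def abs_mult flip: right_diff_distrib)
      ultimately show ?thesis using subedge_length_pair[OF \<open>u \<noteq> v\<close>] e True by simp
    next
      case False
      then have "u \<notin> e \<or> v \<notin> e" using e(1) \<open>u \<noteq> v\<close> by (auto elim!: edgeE)
      then have "\<phi> r = 0" if "r \<in> cell_points e" for r
        using that by (auto simp: \<phi>_def cell_points_def min_absorb1 min_absorb2)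
      with e show ?thesis by (simp add: subedge_length_nonneg)
    qed
  qed fact+
  moreover have "\<phi> q = 0" using assms(4-6) by (auto simp: \<phi>_def)
  ultimately have "\<phi> p \<le> d p q" by linarith
  then show ?thesis by (simp add: \<phi>_def)
qed

section \<open>Lipschitz curves and geodesics\<close>

text \<open>Only an upper bound on distances is required, so these curves can be concatenated
  freely, which geodesics cannot. They become geodesics as soon as \<open>L\<close> is at most the
  distance of the ends.\<close>

definition lip_curve :: "('a \<Rightarrow> real) \<Rightarrow> ('a \<Rightarrow> real) \<Rightarrow> real \<Rightarrow> ('a \<Rightarrow> real) set \<Rightarrow> bool" where
  "lip_curve p q L S \<longleftrightarrow> 0 \<le> L \<and> S \<subseteq> X \<and>
     (\<exists>g. g 0 = p \<and> g L = q \<and> g ` {0..L} = S \<and>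
        (\<forall>s\<in>{0..L}. \<forall>t\<in>{0..L}. s \<le> t \<longrightarrow> d (g s) (g t) \<le> t - s))"

lemma lip_curve_dist_le:
  assumes "lip_curve p q L S"
  shows "d p q \<le> L"
proof -
  obtain g where "0 \<le> L" "g 0 = p" "g L = q"
      "\<forall>s\<in>{0..L}. \<forall>t\<in>{0..L}. s \<le> t \<longrightarrow> d (g s) (g t) \<le> t - s"
    using assms by (auto simp: lip_curve_def)
  then show ?thesis by (metis atLeastAtMost_iff diff_zero order_refl)
qed

lemma lip_curve_refl: "p \<in> X \<Longrightarrow> lip_curve p p 0 {p}"
  by (auto simp: lip_curve_def dist_self intro!: exI[of _ "\<lambda>_. p"])

text \<open>The edge is parametrized by length. The weight has to be positive because the parameter
  is divided by it to give the coordinate at \<open>v\<close>.\<close>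

lemma lip_curve_edge:
  assumes uv: "{u, v} \<in> E" and pos: "0 < \<omega> {u, v}"
  shows "lip_curve (vertex_point u) (vertex_point v) (\<omega> {u, v}) (cell_points {u, v})"
proof -
  have "u \<noteq> v" using uv by (rule edge_distinct)
  define l where "l = \<omega> {u, v}"
  define g :: "real \<Rightarrow> 'a \<Rightarrow> real" where
    "g s = (\<lambda>x. if x = u then 1 - s / l else if x = v then s / l else 0)" for s
  have l: "0 < l" using pos by (simp add: l_def)
  have g: "g s \<in> cell_points {u, v}" if "s \<in> {0..l}" for s
    using that l \<open>u \<noteq> v\<close> by (auto simp: cell_points_def g_def)
  have "g ` {0..l} = cell_points {u, v}"
  proof (intro equalityI subsetI)
    fix p assume p: "p \<in> cell_points {u, v}"
    note D = cell_points_pairD[OF \<open>u \<noteq> v\<close> p]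
    have "p = g (l * p v)" using D l \<open>u \<noteq> v\<close> by (auto simp: g_def fun_eq_iff)
    moreover have "l * p v \<in> {0..l}" using D l by auto
    ultimately show "p \<in> g ` {0..l}" by blast
  qed (use g in auto)
  moreover have "d (g s) (g t) \<le> t - s" if st: "s \<in> {0..l}" "t \<in> {0..l}" "s \<le> t" for s t
  proof -
    have "d (g s) (g t) \<le> subedge_length \<omega> {u, v} (g s) (g t)"
      by (intro dist_le pl_path_single uv g st)
    also have "\<dots> = l * \<bar>g s u - g t u\<bar>"
      using subedge_length_pair[OF \<open>u \<noteq> v\<close> g g] st by (simp add: l_def)
    also have "g s u - g t u = (t - s) / l"
      using l by (simp add: g_def diff_divide_distrib)
    also have "l * \<bar>(t - s) / l\<bar> = t - s" using l st by (simp add: abs_divide)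
    finally show ?thesis .
  qed
  moreover have "g 0 = vertex_point u" "g l = vertex_point v"
    using l \<open>u \<noteq> v\<close> by (auto simp: g_def fun_eq_iff indicator_def)
  ultimately show ?thesis
    using l cell_points_subset_X[OF uv] unfolding lip_curve_def l_def[symmetric]
    by (intro conjI exI[of _ g]) auto
qed

lemma lip_curve_append:
  assumes "lip_curve p q L S" "lip_curve q r L' S'"
  shows "lip_curve p r (L + L') (S \<union> S')"
proof -
  obtain g where g: "g 0 = p" "g L = q" "g ` {0..L} = S"
      "\<And>s t. 0 \<le> s \<Longrightarrow> s \<le> t \<Longrightarrow> t \<le> L \<Longrightarrow> d (g s) (g t) \<le> t - s"
    using assms(1) by (auto simp: lip_curve_def)
  obtain h where h: "h 0 = q" "h L' = r" "h ` {0..L'} = S'"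
      "\<And>s t. 0 \<le> s \<Longrightarrow> s \<le> t \<Longrightarrow> t \<le> L' \<Longrightarrow> d (h s) (h t) \<le> t - s"
    using assms(2) by (auto simp: lip_curve_def)
  have L: "0 \<le> L" "0 \<le> L'" and S: "S \<subseteq> X" "S' \<subseteq> X" using assms by (auto simp: lip_curve_def)
  define k where "k s = (if s \<le> L then g s else h (s - L))" for s
  have k: "k s = h (s - L)" if "L \<le> s" for s
    using that g(2) h(1) by (cases "s = L") (auto simp: k_def)
  have "k ` {0..L} = S" using g(3) by (auto simp: k_def)
  moreover have "k ` {L..L + L'} = S'"
  proof -
    have "k ` {L..L + L'} = (\<lambda>s. h (s - L)) ` {L..L + L'}" by (intro image_cong) (auto simp: k)
    also have "\<dots> = h ` ((\<lambda>s. s - L) ` {L..L + L'})" by (simp only: image_image)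
    also have "(\<lambda>s. s - L) ` {L..L + L'} = {0..L'}"
      by (simp add: image_diff_atLeastAtMost)
    finally show ?thesis using h by simp
  qed
  moreover have "{0..L + L'} = {0..L} \<union> {L..L + L'}" using L by auto
  ultimately have im: "k ` {0..L + L'} = S \<union> S'" by (simp add: image_Un)
  have "d (k s) (k t) \<le> t - s" if st: "s \<in> {0..L + L'}" "t \<in> {0..L + L'}" "s \<le> t" for s t
  proof -
    \<comment> \<open>Parameters on different sides of \<open>L\<close> are compared through the
      common point \<open>q\<close>.\<close>
    consider "t \<le> L" | "L \<le> s" | "s < L" "L < t" by linarith
    then show ?thesis
    proof cases
      case 1
      then show ?thesis using st g(4)[of s t] by (simp add: k_def)
    next
      case 2
      then show ?thesis using st h(4)[of "s - L" "t - L"] by (simp add: k)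
    next
      case 3
      have "g s \<in> S" "q \<in> S" "h (t - L) \<in> S'"
        using 3 st L g(2,3) h(3) by (auto simp flip: g(2,3) h(3))
      then have "d (g s) (h (t - L)) \<le> d (g s) q + d q (h (t - L))"
        using S by (intro dist_triangle) auto
      moreover have "d (g s) q \<le> L - s" using g(4)[of s L] 3 st g(2) by simp
      moreover have "d q (h (t - L)) \<le> t - L" using h(4)[of 0 "t - L"] 3 st h(1) by simp
      ultimately show ?thesis using 3 by (simp add: k_def)
    qed
  qed
  moreover have "k 0 = p" "k (L + L') = r" using L g h by (auto simp: k k_def)
  ultimately show ?thesis using im L S unfolding lip_curve_def by (intro conjI exI[of _ k]) auto
qed

lemma lip_curve_path:
  assumes "edge_path V E x y xs"
    and "\<And>i. Suc i < length xs \<Longrightarrow> 0 < \<omega> {xs ! i, xs ! Suc i}"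
  shows "lip_curve (vertex_point x) (vertex_point y) (path_length \<omega> xs) (path_points xs)"
  using assms
proof (induction xs arbitrary: x rule: induct_list012)
  case (2 a)
  then show ?case by (auto simp: edge_path_def intro!: lip_curve_refl)
next
  case (3 a b xs)
  then have "edge_path V E b y (b # xs)" "{a, b} \<in> E" "x = a" by (auto simp: edge_path_def)
  moreover have "0 < \<omega> {(b # xs) ! i, (b # xs) ! Suc i}" if "Suc i < length (b # xs)" for i
    using 3(4)[of "Suc i"] that by simp
  moreover have "0 < \<omega> {a, b}" using 3(4)[of 0] by simp
  ultimately show ?case
    using lip_curve_append[OF lip_curve_edge 3(2)] by simp
qed (simp add: edge_path_def)

text \<open>For parameters \<open>s \<le> t\<close> the three pieces of the curve have lengths at
  most \<open>s\<close>, \<open>t - s\<close> and \<open>L - t\<close>, with sum \<open>L\<close>.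
  As the ends are at distance at least \<open>L\<close>, the triangle inequality leaves no slack in
  any piece.\<close>

lemma geodesic_of_lip_curve:
  assumes "lip_curve p q L S" "L \<le> d p q"
  shows "geodesic_segment X d p q S"
proof -
  obtain g where g: "g 0 = p" "g L = q" "g ` {0..L} = S"
      "\<And>s t. 0 \<le> s \<Longrightarrow> s \<le> t \<Longrightarrow> t \<le> L \<Longrightarrow> d (g s) (g t) \<le> t - s"
    using assms(1) by (auto simp: lip_curve_def)
  have S: "S \<subseteq> X" and L: "0 \<le> L" using assms(1) by (auto simp: lip_curve_def)
  have gX: "g s \<in> X" if "0 \<le> s" "s \<le> L" for s using that g(3) S by auto
  have eq: "d (g s) (g t) = t - s" if st: "0 \<le> s" "s \<le> t" "t \<le> L" for s t
  proof -
    have "L \<le> d (g 0) (g L)" using assms(2) g by simp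
    also have "\<dots> \<le> d (g 0) (g s) + d (g s) (g L)" using st L by (intro dist_triangle gX) auto
    also have "d (g s) (g L) \<le> d (g s) (g t) + d (g t) (g L)"
      using st L by (intro dist_triangle gX) auto
    finally show ?thesis using g(4)[of 0 s] g(4)[of s t] g(4)[of t L] st by simp
  qed
  have "d (g s) (g t) = \<bar>s - t\<bar>" if "s \<in> {0..L}" "t \<in> {0..L}" for s t
    using eq[of s t] eq[of t s] that by (cases "s \<le> t") (auto simp: dist_commute)
  then show ?thesis unfolding geodesic_segment_def using g L S by blast
qed

lemma geodesic_segment_mem:
  assumes "geodesic_segment X d p q S" "w \<in> S"
  shows "d p w + d w q = d p q" "w \<in> X"
  using assms by (force simp: geodesic_segment_def)+

end

section \<open>Short cycles in hyperbolic graphs\<close>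

lemma edge_path_take:
  assumes "edge_path V E x y xs" "i < length xs"
  shows "edge_path V E x (xs ! i) (take (Suc i) xs)"
  using assms
  by (auto simp: edge_path_def successively_conv_nth take_Suc_conv_app_nth nth_append less_Suc_eq
      hd_append hd_conv_nth dest: in_set_takeD)

text \<open>Initial segments of a path that starts at \<open>x\<close> end in the component, so the
  path never leaves it. Being connected, a component can fail to be a tree only by containing a
  cycle.\<close>

lemma component_connected:
  assumes "C \<in> graph_components W (induced_edges E W)"
  shows "connected_graph C (induced_edges E C)" "C \<subseteq> W"
proof -
  let ?F = "induced_edges E W" and ?G = "induced_edges E C"
  obtain x where x: "x \<in> W" and C: "C = {y. \<exists>xs. edge_path W ?F x y xs}"
    using assms by (auto simp: graph_components_def)
  show "C \<subseteq> W" by (auto simp: C edge_path_def)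
  have "edge_path W ?F x x [x]" using x by (auto simp: edge_path_def)
  then have "x \<in> C" by (auto simp: C)
  have path: "\<exists>xs. edge_path C ?G x y xs" if y: "y \<in> C" for y
  proof -
    obtain xs where xs: "edge_path W ?F x y xs" using y C by blast
    have nth: "xs ! i \<in> C" if "i < length xs" for i
      using edge_path_take[OF xs that] by (auto simp: C)
    have "{xs ! i, xs ! Suc i} \<in> ?G" if "Suc i < length xs" for i
      using xs that nth[of i] nth[of "Suc i"]
      by (auto simp: edge_path_def induced_edges_def successively_conv_nth)
    moreover have "set xs \<subseteq> C" using nth by (auto simp: in_set_conv_nth)
    ultimately have "edge_path C ?G x y xs"
      using xs by (auto simp: edge_path_def successively_conv_nth)
    then show ?thesis ..
  qed
  have "\<exists>xs. edge_path C ?G y z xs" if "y \<in> C" "z \<in> C" for y z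
    using path[OF that(1)] path[OF that(2)] by (blast intro: edge_path_append edge_path_rev)
  then show "connected_graph C ?G" using \<open>x \<in> C\<close> by (auto simp: connected_graph_def)
qed

lemma arc_edge_path:
  assumes "i \<le> j" "\<And>l. i \<le> l \<Longrightarrow> l \<le> j \<Longrightarrow> a l \<in> V"
    and "\<And>l. i \<le> l \<Longrightarrow> l < j \<Longrightarrow> {a l, a (Suc l)} \<in> E"
  shows "edge_path V E (a i) (a j) (map a [i..<Suc j])"
  using assms
  by (auto simp: edge_path_def successively_conv_nth hd_map last_map nth_append
      simp del: upt_Suc)

lemma is_cycle_nth_mod:
  assumes "is_cycle V E xs"
  shows "{xs ! (i mod length xs), xs ! (Suc i mod length xs)} \<in> E"
proof -
  let ?n = "length xs"
  have n: "3 \<le> ?n" and c: "{last xs, hd xs} \<in> E"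
    and s: "\<And>i. Suc i < ?n \<Longrightarrow> {xs ! i, xs ! Suc i} \<in> E"
    using assms by (auto simp: is_cycle_def successively_conv_nth)
  have "i mod ?n < ?n" using n by (intro mod_less_divisor) linarith
  then consider "Suc (i mod ?n) < ?n" | "Suc (i mod ?n) = ?n" by linarith
  then show ?thesis
  proof cases
    case 1
    then show ?thesis using s[of "i mod ?n"] by (simp add: mod_Suc)
  next
    case 2
    then have "i mod ?n = ?n - 1" by simp
    moreover have "xs \<noteq> []" using n by auto
    ultimately show ?thesis using 2 c by (simp add: mod_Suc last_conv_nth hd_conv_nth)
  qed
qed

section \<open>The combinatorial distance\<close>

text \<open>The number of edges of a shortest path. For connected graphs with unit weights it agrees
  with the distance of the vertex points in the realization, and as a natural number it is easier to
  minimize and to compare with indices.\<close>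

definition gdist :: "'a set \<Rightarrow> 'a set set \<Rightarrow> 'a \<Rightarrow> 'a \<Rightarrow> nat" where
  "gdist V E x y = (LEAST n. \<exists>xs. edge_path V E x y xs \<and> length xs = Suc n)"

locale unit_graph = weighted_graph V E "\<lambda>_. 1" for V :: "'a set" and E :: "'a set set"
begin

abbreviation "gd \<equiv> gdist V E"

lemma shortest_path:
  assumes "x \<in> V" "y \<in> V"
  obtains xs where "edge_path V E x y xs" "length xs = Suc (gd x y)"
proof -
  obtain ys where ys: "edge_path V E x y ys"
    using connected assms by (auto simp: connected_graph_def)
  then have "length ys = Suc (length ys - 1)" by (cases ys) (auto simp: edge_path_def)
  with ys have "\<exists>n xs. edge_path V E x y xs \<and> length xs = Suc n" by blast
  from LeastI_ex[OF this] that show ?thesis by (auto simp: gdist_def)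
qed

lemma gdist_le:
  assumes "edge_path V E x y xs" "length xs \<le> Suc n"
  shows "gd x y \<le> n"
proof -
  have "length xs = Suc (length xs - 1)" using assms by (cases xs) (auto simp: edge_path_def)
  with assms have "gd x y \<le> length xs - 1" unfolding gdist_def by (intro Least_le) blast
  with assms(2) show ?thesis by simp
qed

lemma gdist_triangle:
  assumes "x \<in> V" "y \<in> V" "z \<in> V"
  shows "gd x z \<le> gd x y + gd y z"
proof -
  obtain xs where xs: "edge_path V E x y xs" "length xs = Suc (gd x y)"
    using shortest_path assms by blast
  obtain ys where ys: "edge_path V E y z ys" "length ys = Suc (gd y z)"
    using shortest_path assms by blast
  from gdist_le[OF edge_path_append[OF xs(1) ys(1)]] xs ys show ?thesis by simp
qed

lemma gdist_commute_le: "x \<in> V \<Longrightarrow> y \<in> V \<Longrightarrow> gd x y \<le> gd y x"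
  by (metis shortest_path edge_path_rev gdist_le length_rev order_refl)

lemma gdist_commute: "x \<in> V \<Longrightarrow> y \<in> V \<Longrightarrow> gd x y = gd y x"
  by (intro antisym gdist_commute_le)

lemma gdist_arc:
  assumes "i \<le> j" "\<And>l. i \<le> l \<Longrightarrow> l \<le> j \<Longrightarrow> a l \<in> V"
    and "\<And>l. i \<le> l \<Longrightarrow> l < j \<Longrightarrow> {a l, a (Suc l)} \<in> E"
  shows "gd (a i) (a j) \<le> j - i"
  by (rule gdist_le[OF arc_edge_path[of i j a]]) (use assms in auto)

lemma gdist_path_nth:
  assumes "edge_path V E x y xs" "i \<le> j" "j < length xs"
  shows "gd (xs ! i) (xs ! j) \<le> j - i"
  using assms
  by (intro gdist_arc) (auto simp: edge_path_def successively_conv_nth subset_iff)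

lemma gdist_self [simp]: "x \<in> V \<Longrightarrow> gd x x = 0"
  using gdist_le[of x x "[x]" 0] by (auto simp: edge_path_def)

lemma gdist_edge: "{u, v} \<in> E \<Longrightarrow> gd u v \<le> 1"
  using edge_vertices[of u v] gdist_le[of u v "[u, v]" 1] by (auto simp: edge_path_def)

lemma gdist_eq_0_iff: "x \<in> V \<Longrightarrow> y \<in> V \<Longrightarrow> gd x y = 0 \<longleftrightarrow> x = y"
proof
  assume "x \<in> V" "y \<in> V" "gd x y = 0"
  then obtain xs where "edge_path V E x y xs" "length xs = 1" by (metis shortest_path One_nat_def)
  then show "x = y" by (auto simp: edge_path_def length_Suc_conv)
qed simp

lemma path_length_unit: "path_length (\<lambda>_. 1) xs = real (length xs - 1)"
  by (simp add: path_length_conv_nth)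

text \<open>The potential is \<open>gd x\<close>, which changes by at most 1 along an edge.\<close>

lemma gdist_le_dist:
  assumes "x \<in> V" "y \<in> V"
  shows "real (gd x y) \<le> d (vertex_point x) (vertex_point y)"
proof -
  have "\<bar>real (gd x x) - real (gd x y)\<bar> \<le> d (vertex_point x) (vertex_point y)"
  proof (rule potential_le_dist)
    fix u v assume uv: "{u, v} \<in> E"
    then have "u \<in> V" "v \<in> V" by (auto dest: edge_vertices)
    then show "\<bar>real (gd x u) - real (gd x v)\<bar> \<le> 1"
      using gdist_triangle[of x u v] gdist_triangle[of x v u] gdist_edge[of u v] uv assms
        gdist_commute[of u v] by simp
  qed (use assms in auto)
  then show ?thesis using assms by simp
qed

lemma shortest_path_geodesic:
  assumes "edge_path V E x y xs" "length xs = Suc (gd x y)"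
  shows "geodesic_segment X d (vertex_point x) (vertex_point y) (path_points xs)"
proof (rule geodesic_of_lip_curve[OF lip_curve_path[OF assms(1)]])
  have "x \<in> V" "y \<in> V" using assms(1) by (auto simp: edge_path_def)
  then show "path_length (\<lambda>_. 1) xs \<le> d (vertex_point x) (vertex_point y)"
    using gdist_le_dist by (simp add: path_length_unit assms(2))
qed simp

lemma dist_eq_gdist:
  assumes "x \<in> V" "y \<in> V"
  shows "d (vertex_point x) (vertex_point y) = real (gd x y)"
proof (rule antisym)
  obtain xs where xs: "edge_path V E x y xs" "length xs = Suc (gd x y)"
    using shortest_path assms by blast
  show "d (vertex_point x) (vertex_point y) \<le> real (gd x y)"
    using lip_curve_dist_le[OF lip_curve_path[OF xs(1)]] xs(2) by (simp add: path_length_unit)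
qed (rule gdist_le_dist[OF assms])

text \<open>A slim triangle over a geodesic arc cannot have its midpoint farther from the third corner
  than the ends of the arc. Hence near a farthest point a closed path always has a shortcut.\<close>

lemma arc_at_farthest_point_not_geodesic:
  assumes hyp: "delta_hyperbolic X d \<delta>" and m: "2 * \<delta> < real m"
    and V: "\<And>l. l \<le> 2 * m \<Longrightarrow> a l \<in> V"
    and E: "\<And>l. l < 2 * m \<Longrightarrow> {a l, a (Suc l)} \<in> E"
    and p: "p \<in> V" and far: "gd p (a 0) \<le> gd p (a m)" "gd p (a (2 * m)) \<le> gd p (a m)"
  shows "gd (a 0) (a (2 * m)) < 2 * m"
proof (rule ccontr)
  let ?y = "vertex_point (a 0)" and ?x = "vertex_point (a m)" and ?z = "vertex_point (a (2 * m))"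
    and ?p = "vertex_point p"
  assume "\<not> gd (a 0) (a (2 * m)) < 2 * m"
  moreover have half: "gd (a 0) (a m) \<le> m" "gd (a m) (a (2 * m)) \<le> m"
    using gdist_arc[of 0 m a] gdist_arc[of m "2 * m" a] V E by auto
  moreover have "gd (a 0) (a (2 * m)) \<le> gd (a 0) (a m) + gd (a m) (a (2 * m))"
    by (intro gdist_triangle V) auto
  \<comment> \<open>Without a shortcut the whole arc is a geodesic and its two halves have length
    exactly \<open>m\<close>.\<close>
  ultimately have gd: "gd (a 0) (a (2 * m)) = 2 * m" "gd (a 0) (a m) = m" "gd (a m) (a (2 * m)) = m"
    by linarith+
  define S1 where "S1 = path_points (map a [0..<Suc (2 * m)])"
  have S1: "geodesic_segment X d ?y ?z S1"
    unfolding S1_def using arc_edge_path[of 0 "2 * m" a] V E gd(1)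
    by (intro shortest_path_geodesic) auto
  have aV: "a 0 \<in> V" "a m \<in> V" "a (2 * m) \<in> V" using V by auto
  obtain S2 where S2: "geodesic_segment X d ?z ?p S2"
    using shortest_path[OF aV(3) p] shortest_path_geodesic by metis
  obtain S3 where S3: "geodesic_segment X d ?p ?y S3"
    using shortest_path[OF p aV(1)] shortest_path_geodesic by metis
  have "geodesic_triangle X d S1 S2 S3"
    unfolding geodesic_triangle_def using S1 S2 S3 aV p by (meson vertex_point_in_X)
  then have "S1 \<subseteq> neighborhood_of X d \<delta> (S2 \<union> S3)"
    using hyp by (auto simp: delta_hyperbolic_def slim_triangle_def)
  moreover have "?x \<in> S1"
    unfolding S1_def by (intro vertex_point_in_path_points) (auto simp del: upt_Suc)
  ultimately obtain w where w: "w \<in> S2 \<union> S3" "d ?x w \<le> \<delta>"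
    by (auto simp: neighborhood_of_def)
  \<comment> \<open>The point \<open>w\<close> near the midpoint lies on a side that joins
    \<open>p\<close> to an end \<open>b\<close> of the arc.\<close>
  have "\<exists>b\<in>{a 0, a (2 * m)}. d ?p w + d w (vertex_point b) = d ?p (vertex_point b) \<and> w \<in> X"
    using geodesic_segment_mem[OF S2, of w] geodesic_segment_mem[OF S3, of w] w(1)
      dist_commute[of ?z w] dist_commute[of ?p w] dist_commute[of ?p ?z] by force
  then obtain b where b: "b \<in> {a 0, a (2 * m)}"
    "d ?p w + d w (vertex_point b) = d ?p (vertex_point b)" "w \<in> X" by blast
  have bV: "b \<in> V" "gd p b \<le> gd p (a m)" "gd (a m) b = m"
    using b(1) aV gd far gdist_commute[of "a 0" "a m"] by auto
  \<comment> \<open>On this side \<open>d ?p w\<close> is at least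
    \<open>d ?p ?x - \<delta>\<close>, and the rest up to \<open>b\<close> is at least
    \<open>m - \<delta>\<close>. Since \<open>m\<close> exceeds \<open>2 * \<delta>\<close>, the end
    \<open>b\<close> would be farther from \<open>p\<close> than the midpoint.\<close>
  have "d ?p ?x \<le> d ?p w + d w ?x" using p aV b by (intro dist_triangle) auto
  moreover have "d ?x (vertex_point b) \<le> d ?x w + d w (vertex_point b)"
    using bV aV b by (intro dist_triangle) auto
  moreover have "d ?x (vertex_point b) = m" "d ?p (vertex_point b) \<le> d ?p ?x"
    using bV aV p by (auto simp: dist_eq_gdist)
  ultimately show False using w(2) m b(2) dist_commute[of w ?x] by linarith
qed

text \<open>Take a subarc with as few edges as possible among those that have a shortcut. A shortest
  path between its ends meets it only there, since an inner meeting point would split off a smaller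
  subarc with a shortcut. The subarc and the path form a cycle.\<close>

lemma cycle_of_shortcut:
  assumes inj: "inj_on a {..k}"
    and V: "\<And>l. l \<le> k \<Longrightarrow> a l \<in> V"
    and E: "\<And>l. l < k \<Longrightarrow> {a l, a (Suc l)} \<in> E"
    and short: "gd (a 0) (a k) < k"
  obtains xs where "is_cycle V E xs" "length xs \<le> 2 * k"
    "\<And>v. v \<in> set xs \<Longrightarrow> \<exists>l\<le>k. gd (a l) v \<le> k"
proof -
  \<comment> \<open>\<open>P n\<close> says that some subarc with \<open>n\<close> edges has a
    shortcut.\<close>
  define P where "P n \<longleftrightarrow> (\<exists>i j. i \<le> j \<and> j \<le> k \<and> j - i = n \<and> gd (a i) (a j) < n)" for n
  define n where "n = (LEAST n. P n)"
  have "P k" unfolding P_def using short by (intro exI[of _ 0] exI[of _ k]) auto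
  then have "P n" unfolding n_def by (rule LeastI)
  then obtain i j where ij: "i \<le> j" "j \<le> k" "j - i = n" "gd (a i) (a j) < n"
    by (auto simp: P_def)
  have least: "s - r \<le> gd (a r) (a s)" if "r \<le> s" "s \<le> k" "s - r < n" for r s
  proof -
    have "\<not> P (s - r)" using that(3) unfolding n_def by (rule not_less_Least)
    then show ?thesis using that by (auto simp: P_def not_less)
  qed
  define l where "l = gd (a i) (a j)"
  obtain zs where zs: "edge_path V E (a i) (a j) zs" "length zs = Suc l"
    using shortest_path[of "a i" "a j"] V ij unfolding l_def by (metis le_trans)
  have zs0: "zs ! 0 = a i" and zsl: "zs ! l = a j" and zsV: "set zs \<subseteq> V" "zs \<noteq> []"
    and zsE: "\<And>r. r < l \<Longrightarrow> {zs ! r, zs ! Suc r} \<in> E"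
    using zs by (auto simp: edge_path_def hd_conv_nth last_conv_nth successively_conv_nth)
  have nthV: "zs ! r \<in> V" if "r \<le> l" for r
    using zsV zs(2) that by (simp add: subset_iff)
  have left: "gd (a i) (zs ! r) \<le> r" if "r \<le> l" for r
    using gdist_path_nth[OF zs(1), of 0 r] that zs by (simp add: zs0)
  have right: "gd (zs ! r) (a j) \<le> l - r" if "r \<le> l" for r
    using gdist_path_nth[OF zs(1), of r l] that zs by (simp add: zsl)
  have "zs ! r \<noteq> zs ! s" if "r < s" "s \<le> l" for r s
    using left[of r] right[of s] that gdist_triangle[of "a i" "zs ! r" "a j"] nthV[of r] ij
      V[of i] V[of j] unfolding l_def by force
  then have "distinct zs"
    using zs(2) unfolding distinct_conv_nth by (metis less_Suc_eq_le linorder_neqE_nat)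
  have "a i \<noteq> a j" using inj ij by (auto simp: inj_on_def)
  then have "l \<noteq> 0" using gdist_eq_0_iff[of "a i" "a j"] V ij unfolding l_def by force
  \<comment> \<open>The index ranges leave out \<open>a j\<close> and \<open>zs ! 0\<close>, so that
    each of the two common ends is listed only once in the cycle.\<close>
  have avoid: "a r \<noteq> zs ! s" if r: "i \<le> r" "r < j" and s: "0 < s" "s \<le> l" for r s
  proof
    assume eq: "a r = zs ! s"
    show False
    proof (cases "r = i")
      case True
      then have "zs ! 0 = zs ! s" using eq zs0 by simp
      then show False using \<open>distinct zs\<close> s zs(2) by (simp add: nth_eq_iff_index_eq)
    next
      case False
      \<comment> \<open>By minimality neither part of the subarc has a shortcut, which bounds
        \<open>r - i\<close> by \<open>s\<close> and \<open>j - r\<close> by \<open>l - s\<close>.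
        Adding up gives \<open>n \<le> l\<close>, a contradiction.\<close>
      then have "r - i \<le> gd (a i) (a r)" "j - r \<le> gd (a r) (a j)"
        using r ij by (auto intro!: least)
      moreover have "gd (a i) (a r) \<le> s" "gd (a r) (a j) \<le> l - s"
        using left[OF s(2)] right[OF s(2)] by (simp_all add: eq)
      ultimately show False using s ij(3,4) r unfolding l_def by linarith
    qed
  qed
  \<comment> \<open>Along the subarc from \<open>a i\<close> to \<open>a (j - 1)\<close>, then back
    along \<open>zs\<close> from \<open>a j\<close> to \<open>zs ! 1\<close>; the closing edge leads
    to \<open>zs ! 0 = a i\<close>.\<close>
  define xs where "xs = map a [i..<j] @ rev (tl zs)"
  have tl: "tl zs \<noteq> []" using zs(2) \<open>l \<noteq> 0\<close> by (cases zs) auto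
  have len: "length xs = n + l" using ij zs by (simp add: xs_def)
  have ij': "i < j" using ij by linarith
  have "is_cycle V E xs"
    unfolding is_cycle_def
  proof (intro conjI)
    \<comment> \<open>Here \<open>l\<close> is at least 1 and \<open>n\<close> is larger than
      \<open>l\<close>.\<close>
    show "3 \<le> length xs" using len ij(4) \<open>l \<noteq> 0\<close> unfolding l_def by linarith
    have "set (map a [i..<j]) \<inter> set (tl zs) = {}"
    proof -
      have "a r \<noteq> tl zs ! s" if "i \<le> r" "r < j" "s < length (tl zs)" for r s
        using avoid[OF that(1,2), of "Suc s"] that(3) zs(2) by (simp add: nth_tl)
      then show ?thesis by (fastforce simp: in_set_conv_nth)
    qed
    moreover have "inj_on a {i..<j}" using inj by (rule inj_on_subset) (use ij in auto)
    ultimately show "distinct xs"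
      using \<open>distinct zs\<close> by (auto simp: xs_def distinct_map distinct_tl)
    show "set xs \<subseteq> V"
      using V zsV ij by (auto simp: xs_def dest: list.set_sel(2))
    have 1: "successively (\<lambda>u v. {u, v} \<in> E) (map a [i..<j])"
      using E ij by (auto simp: successively_conv_nth)
    have "successively (\<lambda>u v. {u, v} \<in> E) (tl zs)"
      using zsE zs(2) by (auto simp: successively_conv_nth nth_tl)
    then have 2: "successively (\<lambda>u v. {u, v} \<in> E) (rev (tl zs))"
      by (simp add: insert_commute)
    have "last (map a [i..<j]) = a (j - 1)" using ij' by (simp add: last_map)
    moreover have "hd (rev (tl zs)) = a j"
      using tl zs(1) by (simp add: hd_rev last_tl edge_path_def)
    moreover have "{a (j - 1), a j} \<in> E" using E[of "j - 1"] ij ij' by simp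
    ultimately show "successively (\<lambda>u v. {u, v} \<in> E) xs"
      using 1 2 unfolding xs_def successively_append_iff by simp
    have "last xs = zs ! 1" using tl zs(2) \<open>l \<noteq> 0\<close>
      by (simp add: xs_def last_rev hd_conv_nth nth_tl)
    moreover have "hd xs = a i" using ij' by (simp add: xs_def hd_append hd_map)
    ultimately show "{last xs, hd xs} \<in> E"
      using zsE[of 0] \<open>l \<noteq> 0\<close> zs0 by (simp add: insert_commute)
  qed
  moreover have "length xs \<le> 2 * k" using len ij unfolding l_def by linarith
  moreover have "\<exists>l\<le>k. gd (a l) v \<le> k" if v: "v \<in> set xs" for v
  proof -
    consider r where "i \<le> r" "r < j" "v = a r" | "v \<in> set zs"
      using v by (auto simp: xs_def dest: list.set_sel(2)[OF zsV(2)])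
    then show ?thesis
    proof cases
      case 1
      then show ?thesis using ij V by (intro exI[of _ r]) auto
    next
      case 2
      then obtain r where "r \<le> l" "v = zs ! r" using zs(2) by (auto simp: in_set_conv_nth less_Suc_eq_le)
      then show ?thesis using left[of r] ij unfolding l_def by (intro exI[of _ i]) auto
    qed
  qed
  ultimately show thesis by (rule that)
qed

section \<open>Finite balls and short cycles far away\<close>

lemma finite_incident:
  assumes "bounded_degree V E" "v \<in> V"
  shows "finite {e \<in> E. v \<in> e}" "finite (\<Union>{e \<in> E. v \<in> e})"
proof -
  show fin: "finite {e \<in> E. v \<in> e}" using assms by (auto simp: bounded_degree_def)
  show "finite (\<Union>{e \<in> E. v \<in> e})" using fin by (rule finite_Union) (auto elim: edgeE)
qed

text \<open>Induction on the radius: apart from \<open>b\<close>, a vertex at distance at most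
  \<open>Suc r\<close> lies on an edge that meets the ball of radius \<open>r\<close>, and only
  finitely many edges do.\<close>

lemma finite_gdist_ball:
  assumes "bounded_degree V E" "b \<in> V"
  shows "finite {v \<in> V. gd b v \<le> r}"
proof (induction r)
  case 0
  have "{v \<in> V. gd b v \<le> 0} \<subseteq> {b}" using assms(2) by (auto simp: gdist_eq_0_iff)
  then show ?case by (rule finite_subset) simp
next
  case (Suc r)
  have "{v \<in> V. gd b v \<le> Suc r} \<subseteq> insert b (\<Union>u\<in>{v \<in> V. gd b v \<le> r}. \<Union>{e \<in> E. u \<in> e})"
  proof clarify
    fix v assume v: "v \<in> V" "gd b v \<le> Suc r"
      and "v \<notin> (\<Union>u\<in>{v \<in> V. gd b v \<le> r}. \<Union>{e \<in> E. u \<in> e})"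
    show "v = b"
    proof (rule ccontr)
      assume "v \<noteq> b"
      then have "gd b v \<noteq> 0" using v assms by (simp add: gdist_eq_0_iff)
      then obtain l where l: "gd b v = Suc l" using not0_implies_Suc by blast
      obtain xs where xs: "edge_path V E b v xs" "length xs = Suc (gd b v)"
        using shortest_path assms v by blast
      have "gd (xs ! 0) (xs ! l) \<le> l" using gdist_path_nth[OF xs(1), of 0 l] xs l by simp
      moreover have "xs ! 0 = b" "xs ! Suc l = v" "xs ! l \<in> V" "{xs ! l, xs ! Suc l} \<in> E"
        using xs l by (auto simp: edge_path_def hd_conv_nth last_conv_nth successively_conv_nth
            subset_iff)
      ultimately show False
        using v l \<open>v \<notin> _\<close> by fastforce
    qed
  qed
  then show ?case
    by (rule finite_subset) (use Suc finite_incident[OF assms(1)] in auto)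
qed

lemma bounded_vertex_set_finite:
  assumes "finite B" "B \<subseteq> V"
  shows "bounded_vertex_set V E B"
proof -
  let ?D = "(\<lambda>(x, y). vertex_dist V E (\<lambda>_. 1) x y) ` (B \<times> B)"
  have "vertex_dist V E (\<lambda>_. 1) x y \<le> Max ?D" if "x \<in> B" "y \<in> B" for x y
    using assms that by (intro Max_ge) auto
  with assms show ?thesis unfolding bounded_vertex_set_def by blast
qed

text \<open>Remove the \<open>2 * m\<close>-neighborhood of \<open>B\<close> and take a cycle in the
  rest. If it is long, the arc around its farthest vertex has a shortcut, and the resulting short
  cycle stays within \<open>2 * m\<close> of the long one, hence off \<open>B\<close>.\<close>

lemma short_cycles_outside_finite:
  assumes hyp: "gromov_hyperbolic X d" and deg: "bounded_degree V E"
    and not_tree: "\<And>B. bounded_vertex_set V E B \<Longrightarrow>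
      \<exists>C \<in> graph_components (V - B) (induced_edges E (V - B)). \<not> is_tree C (induced_edges E C)"
  obtains K where "\<And>B. finite B \<Longrightarrow> B \<subseteq> V \<Longrightarrow>
    \<exists>xs. is_cycle V E xs \<and> length xs \<le> K \<and> set xs \<inter> B = {}"
proof -
  obtain \<delta> where \<delta>: "delta_hyperbolic X d \<delta>" using hyp by (auto simp: gromov_hyperbolic_def)
  obtain m :: nat where m: "2 * \<delta> < real m" using reals_Archimedean2 by blast
  show thesis
  \<comment> \<open>A shortcut of an arc with \<open>2 * m\<close> edges yields a cycle with at most
    \<open>4 * m\<close> edges.\<close>
  proof (rule that[of "4 * m + 2"])
    fix B assume B: "finite B" "B \<subseteq> V"
    define B' where "B' = (\<Union>b\<in>B. {v \<in> V. gd b v \<le> 2 * m})"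
    have "finite B'" "B' \<subseteq> V"
      using B finite_gdist_ball[OF deg] by (auto simp: B'_def)
    moreover have "B \<subseteq> B'"
    proof
      fix b assume "b \<in> B"
      then show "b \<in> B'" using B gdist_self[of b] unfolding B'_def by force
    qed
    ultimately obtain C where C: "C \<in> graph_components (V - B') (induced_edges E (V - B'))"
        "\<not> is_tree C (induced_edges E C)"
      using not_tree bounded_vertex_set_finite by blast
    with component_connected[OF C(1)] obtain xs where "is_cycle C (induced_edges E C) xs"
      by (auto simp: is_tree_def)
    with component_connected(2)[OF C(1)] have xs: "is_cycle V E xs" "set xs \<inter> B' = {}"
      by (auto simp: is_cycle_def induced_edges_def successively_conv_nth)
    define n where "n = length xs"
    have n: "3 \<le> n" "distinct xs" "set xs \<subseteq> V" using xs by (auto simp: is_cycle_def n_def)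
    show "\<exists>xs. is_cycle V E xs \<and> length xs \<le> 4 * m + 2 \<and> set xs \<inter> B = {}"
    proof (cases "n \<le> 2 * m")
      case True
      then show ?thesis using xs \<open>B \<subseteq> B'\<close> by (intro exI[of _ xs]) (auto simp: n_def disjoint_iff)
    next
      case False
      define p where "p = hd xs"
      have p: "p \<in> V" using n unfolding p_def n_def by (cases xs) auto
      obtain x where x: "x \<in> set xs" "\<And>y. y \<in> set xs \<Longrightarrow> gd p y \<le> gd p x"
      proof -
        have "Max (gd p ` set xs) \<in> gd p ` set xs" using n by (intro Max_in) (auto simp: n_def)
        then obtain x where "x \<in> set xs" "gd p x = Max (gd p ` set xs)" by auto
        then show thesis using that[of x] by simp
      qed
      then obtain i where i: "i < n" "x = xs ! i" by (auto simp: in_set_conv_nth n_def)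
      \<comment> \<open>The cycle is traversed with a shift that puts \<open>x\<close> at index
        \<open>m\<close>. Adding \<open>n\<close> first keeps the subtraction of \<open>m\<close>
        from being truncated.\<close>
      define a where "a l = xs ! ((i + n - m + l) mod n)" for l
      have a: "a l \<in> set xs" for l
        unfolding a_def using n by (intro nth_mem) (simp add: n_def[symmetric])
      have "a m = x" using False i by (simp add: a_def)
      \<comment> \<open>The indices \<open>0\<close> to \<open>2 * m\<close> differ by less than
        \<open>n\<close>, so they are distinct modulo \<open>n\<close>.\<close>
      have inj: "inj_on a {..2 * m}"
      proof (rule inj_onI)
        fix r s assume rs: "r \<in> {..2 * m}" "s \<in> {..2 * m}" "a r = a s"
        have "(i + n - m + r) mod n = (i + n - m + s) mod n"
          using rs(3) n unfolding a_def by (subst (asm) nth_eq_iff_index_eq) (auto simp flip: n_def)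
        then have "int n dvd int (i + n - m + r) - int (i + n - m + s)"
          by (simp only: of_nat_mod flip: mod_eq_dvd_iff) (metis of_nat_mod)
        then have "int n dvd int r - int s" by simp
        moreover have "\<bar>int r - int s\<bar> < int n" using rs False by auto
        ultimately have "int r - int s = 0" using dvd_imp_le_int[of "int r - int s" "int n"] by linarith
        then show "r = s" by simp
      qed
      have aE: "{a l, a (Suc l)} \<in> E" for l
        using is_cycle_nth_mod[OF xs(1), of "i + n - m + l"] by (simp add: a_def n_def)
      have "gd (a 0) (a (2 * m)) < 2 * m"
        using arc_at_farthest_point_not_geodesic[OF \<delta> m, of a p] a n(3) aE p x(2) \<open>a m = x\<close>
        by (metis subsetD)
      from cycle_of_shortcut[OF inj _ aE this] a n(3) obtain ys where ys: "is_cycle V E ys"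
        "length ys \<le> 2 * (2 * m)" "\<And>v. v \<in> set ys \<Longrightarrow> \<exists>l\<le>2 * m. gd (a l) v \<le> 2 * m"
        by (metis subsetD)
      have "v \<notin> B" if v: "v \<in> set ys" for v
      proof
        assume "v \<in> B"
        obtain l where "gd (a l) v \<le> 2 * m" using ys(3) v by blast
        moreover have "a l \<in> V" "v \<in> V" using a n(3) \<open>v \<in> B\<close> B by auto
        ultimately have "a l \<in> B'"
          using \<open>v \<in> B\<close> gdist_commute[of v "a l"] by (auto simp: B'_def intro!: bexI[of _ v])
        then show False using a[of l] xs(2) by blast
      qed
      with ys show ?thesis by (intro exI[of _ ys]) auto
    qed
  qed
qed

end

section \<open>Fat triangles\<close>

definition cycle_edge :: "'a list \<Rightarrow> nat \<Rightarrow> 'a set" where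
  "cycle_edge xs i = {xs ! i, xs ! (Suc i mod length xs)}"

text \<open>Besides the edges of the cycle this contains its chords and the edges leaving it. Cycles
  with disjoint stars give independent events.\<close>

definition cycle_star :: "'a set set \<Rightarrow> 'a list \<Rightarrow> 'a set set" where
  "cycle_star E xs = {e \<in> E. e \<inter> set xs \<noteq> {}}"

text \<open>The weights make the cycle a triangle whose sides are its first edge, its second edge and
  the remaining \<open>n - 2\<close> edges, each of length between \<open>2 L\<close> and \<open>3 L\<close>. The edges leaving the cycle
  are too long to be used as shortcuts.\<close>

definition fat_range :: "real \<Rightarrow> 'a list \<Rightarrow> 'a set \<Rightarrow> real set" where
  "fat_range L xs e =
     (if e = cycle_edge xs 0 \<or> e = cycle_edge xs 1 then {2 * L <..< 3 * L}
      else if \<exists>i<length xs. e = cycle_edge xs i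
        then {2 * L / real (length xs - 2) <..< 3 * L / real (length xs - 2)}
      else {3 * L <..< 4 * L})"

definition fat_cycle :: "'a set set \<Rightarrow> ('a set \<Rightarrow> real) \<Rightarrow> real \<Rightarrow> 'a list \<Rightarrow> bool" where
  "fat_cycle E \<omega> L xs \<longleftrightarrow> (\<forall>e\<in>cycle_star E xs. \<omega> e \<in> fat_range L xs e)"

lemma cycle_edge_in:
  assumes "is_cycle V E xs" "i < length xs"
  shows "cycle_edge xs i \<in> E"
  using is_cycle_nth_mod[OF assms(1), of i] assms(2) by (simp add: cycle_edge_def)

section \<open>Distances along a fat cycle\<close>

context weighted_graph
begin

text \<open>Extend \<open>f\<close> by 0 off the cycle. All values lie between 0 and
  \<open>b\<close>, so an edge that meets the cycle without belonging to it cannot violate the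
  Lipschitz condition when its weight is at least \<open>b\<close>.\<close>

lemma cycle_potential_le_dist:
  fixes f :: "nat \<Rightarrow> real"
  assumes cyc: "is_cycle V E xs"
    and bound: "\<And>i. i < length xs \<Longrightarrow> 0 \<le> f i \<and> f i \<le> b"
    and step: "\<And>i. i < length xs \<Longrightarrow> \<bar>f i - f (Suc i mod length xs)\<bar> \<le> \<omega> (cycle_edge xs i)"
    and off: "\<And>e. e \<in> cycle_star E xs \<Longrightarrow> \<forall>i<length xs. e \<noteq> cycle_edge xs i \<Longrightarrow> b \<le> \<omega> e"
    and ij: "i < length xs" "j < length xs"
  shows "\<bar>f i - f j\<bar> \<le> d (vertex_point (xs ! i)) (vertex_point (xs ! j))"
proof -
  let ?n = "length xs"
  have xs: "distinct xs" "set xs \<subseteq> V" "3 \<le> ?n" using cyc by (auto simp: is_cycle_def)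
  define D where "D v = (if v \<in> set xs then f (inv_into {..<?n} ((!) xs) v) else 0)" for v
  have inj: "inj_on ((!) xs) {..<?n}" using xs by (simp add: inj_on_nth)
  have Dnth: "D (xs ! k) = f k" if "k < ?n" for k
    using that inv_into_f_f[OF inj, of k] by (simp add: D_def)
  have Db: "0 \<le> D v \<and> D v \<le> b" for v
  proof (cases "v \<in> set xs")
    case True
    then obtain k where "k < ?n" "v = xs ! k" by (auto simp: in_set_conv_nth)
    then show ?thesis using Dnth bound by simp
  next
    case False
    then show ?thesis using bound[OF ij(1)] by (auto simp: D_def)
  qed
  have "\<bar>D (xs ! i) - D (xs ! j)\<bar> \<le> d (vertex_point (xs ! i)) (vertex_point (xs ! j))"
  proof (rule potential_le_dist)
    fix u v assume uv: "{u, v} \<in> E"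
    show "\<bar>D u - D v\<bar> \<le> \<omega> {u, v}"
    proof (cases "{u, v} \<inter> set xs = {}")
      case True
      then show ?thesis using weight_nonneg[OF uv] by (auto simp: D_def)
    next
      case False
      show ?thesis
      proof (cases "\<exists>k<?n. {u, v} = cycle_edge xs k")
        case True
        then obtain k where k: "k < ?n" "{u, v} = cycle_edge xs k" by blast
        have "Suc k mod ?n < ?n" using xs by (intro mod_less_divisor) linarith
        then have "\<bar>D u - D v\<bar> = \<bar>f k - f (Suc k mod ?n)\<bar>"
          using k(2) Dnth[OF k(1)] Dnth[of "Suc k mod ?n"]
          by (auto simp: cycle_edge_def doubleton_eq_iff)
        then show ?thesis using step[OF k(1)] k(2) by simp
      next
        case noncyc: False
        then have "b \<le> \<omega> {u, v}" using off[of "{u, v}"] uv False by (auto simp: cycle_star_def)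
        then show ?thesis using Db[of u] Db[of v] by linarith
      qed
    qed
  qed (use xs ij in auto)
  then show ?thesis using Dnth ij by simp
qed

text \<open>One potential for each side shows that the cycle is a geodesic triangle. The midpoint of
  its first edge has distance at least half the weight of this edge, hence more than
  \<open>L\<close>, from the other two sides.\<close>

lemma fat_cycle_not_hyperbolic:
  assumes cyc: "is_cycle V E xs" and L: "0 < L" and fat: "fat_cycle E \<omega> L xs" and \<delta>: "\<delta> \<le> L"
  shows "\<not> delta_hyperbolic X d \<delta>"
proof
  assume hyp: "delta_hyperbolic X d \<delta>"
  define n where "n = length xs"
  define c where "c i = \<omega> (cycle_edge xs i)" for i
  have xs: "distinct xs" "set xs \<subseteq> V" and n: "3 \<le> n" using cyc by (auto simp: is_cycle_def n_def)
  have nth_eq: "xs ! i = xs ! j \<longleftrightarrow> i = j" if "i < n" "j < n" for i j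
    using xs that by (simp add: nth_eq_iff_index_eq n_def)
  have star: "cycle_edge xs i \<in> cycle_star E xs" if "i < n" for i
    using cycle_edge_in[OF cyc, of i] that by (auto simp: cycle_star_def cycle_edge_def n_def)
  have range: "c i \<in> fat_range L xs (cycle_edge xs i)" if "i < n" for i
    using fat star[OF that] by (auto simp: fat_cycle_def c_def)
  have c01: "2 * L < c 0" "c 0 < 3 * L" "2 * L < c 1" "c 1 < 3 * L"
    using range[of 0] range[of 1] n by (auto simp: fat_range_def)
  \<comment> \<open>The edges of the third side do not touch the corner \<open>xs ! 1\<close>; the
    index \<open>Suc i mod n\<close> wraps around to 0 only.\<close>
  have avoid: "xs ! 1 \<noteq> xs ! i" "xs ! 1 \<noteq> xs ! (Suc i mod n)" if i: "2 \<le> i" "i < n" for i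
  proof -
    have "Suc i mod n < n" "Suc i mod n \<noteq> 1" using i by (cases "Suc i = n"; simp)+
    then show "xs ! 1 \<noteq> xs ! i" "xs ! 1 \<noteq> xs ! (Suc i mod n)" using i n by (auto simp: nth_eq)
  qed
  define h where "h = real (n - 2)"
  have h: "0 < h" using n by (simp add: h_def)
  have ci: "2 * L / h \<le> c i" "c i \<le> 3 * L / h" if i: "2 \<le> i" "i < n" for i
  proof -
    have "xs ! 1 \<notin> cycle_edge xs i" using avoid[OF i] by (simp add: cycle_edge_def n_def)
    moreover have "xs ! 1 \<in> cycle_edge xs 0" "xs ! 1 \<in> cycle_edge xs 1"
      using n by (auto simp: cycle_edge_def n_def[symmetric])
    ultimately have "cycle_edge xs i \<noteq> cycle_edge xs 0" "cycle_edge xs i \<noteq> cycle_edge xs 1" by auto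
    then have "c i \<in> {2 * L / h <..< 3 * L / h}"
      using range[OF i(2)] i by (auto simp: fat_range_def n_def h_def split: if_splits)
    then show "2 * L / h \<le> c i" "c i \<le> 3 * L / h" by auto
  qed
  have ci_pos: "0 < c i" if i: "2 \<le> i" "i < n" for i
  proof -
    have "0 < 2 * L / h" using L h by (intro divide_pos_pos) auto
    then show ?thesis using ci(1)[OF i] by linarith
  qed
  \<comment> \<open>The length along the third side from \<open>xs ! 2\<close> to the vertex with
    index \<open>i\<close>, where \<open>i = n\<close> stands for \<open>xs ! 0\<close>. So
    \<open>s n\<close> is the length of this side.\<close>
  define s where "s i = (\<Sum>j=2..<i. c j)" for i
  have s2: "s 2 = 0" by (simp add: s_def)
  have sSuc: "s (Suc i) = s i + c i" if "2 \<le> i" for i using that by (simp add: s_def)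
  have s_mono: "s i \<le> s n" "0 \<le> s i" if "2 \<le> i" "i \<le> n" for i
    unfolding s_def using that ci_pos
    by (intro sum_mono2 sum_nonneg; force intro: less_imp_le)+
  have "h * (2 * L / h) \<le> s n"
    unfolding s_def using sum_bounded_below[of "{2..<n}" "2 * L / h" c] ci by (simp add: h_def)
  moreover have "s n \<le> h * (3 * L / h)"
    unfolding s_def using sum_bounded_above[of "{2..<n}" c "3 * L / h"] ci by (simp add: h_def)
  ultimately have sn: "2 * L \<le> s n" "s n \<le> 3 * L" using h by auto
  \<comment> \<open>The bound \<open>3 * L\<close> also bounds the three potentials below.\<close>
  have off: "3 * L \<le> \<omega> e" if "e \<in> cycle_star E xs" "\<forall>i<length xs. e \<noteq> cycle_edge xs i" for e
  proof -
    have "e \<noteq> cycle_edge xs 0" "e \<noteq> cycle_edge xs 1" using spec[OF that(2), of 0] spec[OF that(2), of 1] n by (auto simp: n_def)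
    then have "fat_range L xs e = {3 * L <..< 4 * L}" using that(2) by (auto simp: fat_range_def)
    then show ?thesis using fat that(1) by (force simp: fat_cycle_def)
  qed
  have potential: "\<bar>f i - f j\<bar> \<le> d (vertex_point (xs ! i)) (vertex_point (xs ! j))"
    if "\<And>i. i < n \<Longrightarrow> 0 \<le> f i \<and> f i \<le> 3 * L"
      and "\<bar>f 0 - f 1\<bar> \<le> c 0" "\<bar>f 1 - f 2\<bar> \<le> c 1"
      and f: "\<And>i. 2 \<le> i \<Longrightarrow> Suc i < n \<Longrightarrow> \<bar>f i - f (Suc i)\<bar> \<le> c i" "\<bar>f (n - 1) - f 0\<bar> \<le> c (n - 1)"
      and "i < n" "j < n" for f :: "nat \<Rightarrow> real" and i j
  proof (rule cycle_potential_le_dist[OF cyc _ _ off])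
    fix i assume "i < length xs"
    then consider "i = 0" | "i = 1" | "2 \<le> i" "Suc i < n" | "i = n - 1" "2 \<le> i" "i < n"
      using n by (fastforce simp: n_def)
    then show "\<bar>f i - f (Suc i mod length xs)\<bar> \<le> \<omega> (cycle_edge xs i)"
      unfolding n_def[symmetric] c_def[symmetric] using that(2-5) n
      by cases (auto simp: numeral_2_eq_2)
  qed (use that in \<open>auto simp: n_def\<close>)
  have last: "s n - s (n - 1) = c (n - 1)" using sSuc[of "n - 1"] n by simp
  have last_pos: "0 < c (n - 1)" using ci_pos n by simp

  \<comment> \<open>The distance from \<open>xs ! 0\<close> back along the third side, capped at
    \<open>c 0\<close>. Across the second edge it changes by less than \<open>L\<close>, as
    \<open>c 0\<close> is below \<open>3 * L\<close> and \<open>s n\<close> is at least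
    \<open>2 * L\<close>.\<close>
  define f1 where "f1 i = (if i = 0 then 0 else if i = 1 then c 0 else min (c 0) (s n - s i))" for i
  have "\<bar>f1 0 - f1 1\<bar> \<le> d (vertex_point (xs ! 0)) (vertex_point (xs ! 1))"
  proof (rule potential)
    show "0 \<le> f1 i \<and> f1 i \<le> 3 * L" if "i < n" for i
      using that c01 s_mono[of i] sn L by (auto simp: f1_def)
    show "\<bar>f1 i - f1 (Suc i)\<bar> \<le> c i" if "2 \<le> i" "Suc i < n" for i
      using that sSuc[of i] ci_pos[of i] by (auto simp: f1_def)
  qed (use c01 sn s2 L n last last_pos in \<open>auto simp: f1_def\<close>)
  then have d1: "c 0 \<le> d (vertex_point (xs ! 0)) (vertex_point (xs ! 1))"
    using c01 L by (simp add: f1_def)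

  \<comment> \<open>The distance from \<open>xs ! 1\<close> along the first edge and then the third
    side, capped at \<open>c 1\<close>. The cap is reached at \<open>xs ! 2\<close> because two
    sides together are longer than the remaining one.\<close>
  define f2 where "f2 i = (if i = 0 then min (c 1) (c 0) else if i = 1 then 0
    else min (c 1) (c 0 + s n - s i))" for i
  have "\<bar>f2 1 - f2 2\<bar> \<le> d (vertex_point (xs ! 1)) (vertex_point (xs ! 2))"
  proof (rule potential)
    show "0 \<le> f2 i \<and> f2 i \<le> 3 * L" if "i < n" for i
      using that c01 s_mono[of i] sn L by (auto simp: f2_def)
    show "\<bar>f2 i - f2 (Suc i)\<bar> \<le> c i" if "2 \<le> i" "Suc i < n" for i
      using that sSuc[of i] ci_pos[of i] by (auto simp: f2_def)
  qed (use c01 sn s2 L n last last_pos in \<open>auto simp: f2_def\<close>)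
  then have d2: "c 1 \<le> d (vertex_point (xs ! 1)) (vertex_point (xs ! 2))"
    using c01 sn s2 L by (simp add: f2_def)

  \<comment> \<open>The distance from \<open>xs ! 2\<close> along the third side, and along the
    second edge at \<open>xs ! 1\<close>, there capped at \<open>s n\<close>.\<close>
  define f3 where "f3 i = (if i = 0 then s n else if i = 1 then min (c 1) (s n) else s i)" for i
  have "\<bar>f3 2 - f3 0\<bar> \<le> d (vertex_point (xs ! 2)) (vertex_point (xs ! 0))"
  proof (rule potential)
    show "0 \<le> f3 i \<and> f3 i \<le> 3 * L" if "i < n" for i
      using that c01 s_mono[of i] sn L by (auto simp: f3_def)
    show "\<bar>f3 i - f3 (Suc i)\<bar> \<le> c i" if "2 \<le> i" "Suc i < n" for i
      using that sSuc[of i] ci_pos[of i] by (auto simp: f3_def)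
  qed (use c01 sn s2 L n last last_pos in \<open>auto simp: f3_def\<close>)
  then have d3: "s n \<le> d (vertex_point (xs ! 2)) (vertex_point (xs ! 0))"
    using sn s2 L by (simp add: f3_def)

  have edges: "cycle_edge xs 0 = {xs ! 0, xs ! 1}" "cycle_edge xs 1 = {xs ! 1, xs ! 2}"
    using n by (auto simp: cycle_edge_def n_def[symmetric] numeral_2_eq_2)
  have inE: "{xs ! 0, xs ! 1} \<in> E" "{xs ! 1, xs ! 2} \<in> E"
  proof -
    have "0 < length xs" "1 < length xs" using n unfolding n_def by linarith+
    from this[THEN cycle_edge_in[OF cyc]] show "{xs ! 0, xs ! 1} \<in> E" "{xs ! 1, xs ! 2} \<in> E"
      unfolding edges .
  qed
  have V: "xs ! 0 \<in> V" "xs ! 1 \<in> V" "xs ! 2 \<in> V" using inE by (auto dest: edge_vertices)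
  define S1 where "S1 = cell_points {xs ! 0, xs ! 1}"
  define S2 where "S2 = cell_points {xs ! 1, xs ! 2}"
  have S1: "geodesic_segment X d (vertex_point (xs ! 0)) (vertex_point (xs ! 1)) S1"
    unfolding S1_def using geodesic_of_lip_curve[OF lip_curve_edge[OF inE(1)]] d1 c01 L edges
    by (simp add: c_def)
  have S2: "geodesic_segment X d (vertex_point (xs ! 1)) (vertex_point (xs ! 2)) S2"
    unfolding S2_def using geodesic_of_lip_curve[OF lip_curve_edge[OF inE(2)]] d2 c01 L edges
    by (simp add: c_def)
  \<comment> \<open>Periodic indexing makes the third side the arc from index 2 to index
    \<open>n\<close>, ending in \<open>a n = xs ! 0\<close>.\<close>
  define a where "a i = xs ! (i mod n)" for i
  define ys where "ys = map a [2..<Suc n]"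
  have a: "\<omega> {a i, a (Suc i)} = c i" if "i < n" for i
    using that by (simp add: a_def c_def cycle_edge_def n_def)
  have aV: "a i \<in> V" for i
  proof -
    have "i mod n < length xs" using n mod_less_divisor[of n i] unfolding n_def by linarith
    then show ?thesis unfolding a_def using xs(2) by (meson nth_mem subsetD)
  qed
  have ys: "edge_path V E (a 2) (a n) ys"
  proof -
    have "{a i, a (Suc i)} \<in> E" for i
      unfolding a_def n_def by (rule is_cycle_nth_mod[OF cyc])
    then show ?thesis unfolding ys_def using n aV by (intro arc_edge_path) auto
  qed
  have ys_nth: "ys ! i = a (2 + i)" if "i < n - 1" for i
    using that n unfolding ys_def by (simp add: atLeastLessThanSuc_atLeastAtMost del: upt_Suc)
  have len: "length ys = n - 1" using n by (simp add: ys_def)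
  have "path_length \<omega> ys = (\<Sum>i<n - 2. \<omega> {a (2 + i), a (Suc (2 + i))})"
    unfolding path_length_conv_nth len by (intro sum.cong) (auto simp: ys_nth)
  also have "\<dots> = (\<Sum>i<n - 2. c (2 + i))" by (intro sum.cong) (auto simp: a)
  also have "\<dots> = s n"
    unfolding s_def by (rule sum.reindex_bij_witness[of _ "\<lambda>i. i - 2" "\<lambda>i. 2 + i"]) auto
  finally have ys_len: "path_length \<omega> ys = s n" .
  have "a 2 = xs ! 2" "a n = xs ! 0" using n by (simp_all add: a_def)
  moreover have "lip_curve (vertex_point (a 2)) (vertex_point (a n)) (path_length \<omega> ys) (path_points ys)"
    by (rule lip_curve_path[OF ys]) (auto simp: len ys_nth a intro!: ci_pos)
  ultimately have S3: "geodesic_segment X d (vertex_point (xs ! 2)) (vertex_point (xs ! 0)) (path_points ys)"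
    using geodesic_of_lip_curve d3 ys_len by simp
  have "geodesic_triangle X d S1 S2 (path_points ys)"
    unfolding geodesic_triangle_def using S1 S2 S3 V by (meson vertex_point_in_X)
  then have slim: "S1 \<subseteq> neighborhood_of X d \<delta> (S2 \<union> path_points ys)"
    using hyp by (auto simp: delta_hyperbolic_def slim_triangle_def)
  \<comment> \<open>The midpoint of the first edge.\<close>
  define p where "p = (\<lambda>x. if x = xs ! 0 \<or> x = xs ! 1 then 1 / 2 else 0 :: real)"
  have ne: "xs ! 0 \<noteq> xs ! 1" "xs ! 0 \<noteq> xs ! 2" using nth_eq[of 0 1] nth_eq[of 0 2] n by auto
  then have "p \<in> S1" by (auto simp: S1_def p_def cell_points_def)
  then obtain w where w: "w \<in> S2 \<union> path_points ys" "d p w \<le> \<delta>" and p: "p \<in> X"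
    using slim by (auto simp: neighborhood_of_def)
  have "w \<in> X" using w S2 S3 geodesic_segment_mem by blast
  have "\<omega> {xs ! 0, xs ! 1} * min (p (xs ! 0)) (p (xs ! 1)) \<le> d p w"
  proof (rule open_edge_dist)
    \<comment> \<open>The second side does not contain the vertex \<open>xs ! 0\<close>, and the
      third does not contain \<open>xs ! 1\<close>.\<close>
    show "w (xs ! 0) = 0 \<or> w (xs ! 1) = 0"
    proof (cases "w \<in> S2")
      case True
      then show ?thesis using cell_points_outside[of w _ "xs ! 0"] ne by (auto simp: S2_def)
    next
      case False
      have "xs ! 1 \<notin> a ` {2..n}"
      proof
        assume "xs ! 1 \<in> a ` {2..n}"
        then obtain i where i: "xs ! 1 = a i" "2 \<le> i" "i \<le> n" by auto
        show False
        proof (cases "i = n")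
          case True
          then show ?thesis using i(1) ne by (simp add: a_def)
        next
          case False
          then show ?thesis using avoid(1)[of i] i by (simp add: a_def)
        qed
      qed
      moreover have "set ys = a ` {2..n}"
        unfolding ys_def by (simp add: atLeastLessThanSuc_atLeastAtMost del: upt_Suc)
      ultimately have "xs ! 1 \<notin> set ys" by simp
      moreover have "ys \<noteq> []" using len n by auto
      moreover have "w \<in> path_points ys" using False w(1) by simp
      ultimately have "w (xs ! 1) = 0" by (intro path_points_outside)
      then show ?thesis ..
    qed
    show "0 \<le> w (xs ! 0)" "0 \<le> w (xs ! 1)"
      using \<open>w \<in> X\<close> by (auto simp: realization_def cell_points_def indicator_def)
  qed (use inE p \<open>w \<in> X\<close> in auto)
  then have "c 0 / 2 \<le> d p w" using edges by (simp add: p_def c_def)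
  then show False using w \<delta> c01 L by linarith
qed

end

section \<open>Independence\<close>

text \<open>The limes superior of the events has probability at least \<open>\<epsilon>\<close> by
  continuity from above. By the Borel zero-one law its probability is 0 or 1, hence 1.\<close>

lemma (in prob_space) indep_events_AE_ex:
  assumes indep: "indep_events A (UNIV :: nat set)" and \<epsilon>: "0 < \<epsilon>" "\<And>n. \<epsilon> \<le> prob (A n)"
  shows "AE x in M. \<exists>n. x \<in> A n"
proof -
  have A: "A n \<in> events" for n using indep by (auto simp: indep_events_def)
  define U where "U n = (\<Union>m\<in>{n..}. A m)" for n
  have U: "U n \<in> events" for n unfolding U_def using A by auto
  have "\<epsilon> \<le> prob (U n)" for n
  proof -
    have "prob (A n) \<le> prob (U n)"
      using U by (intro finite_measure_mono) (auto simp: U_def)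
    then show ?thesis using \<epsilon>(2)[of n] by simp
  qed
  moreover have "(\<lambda>n. prob (U n)) \<longlonglongrightarrow> prob (\<Inter>n. U n)"
    using U by (intro finite_Lim_measure_decseq) (auto simp: decseq_def U_def intro: order_trans)
  ultimately have "\<epsilon> \<le> prob (\<Inter>n. U n)" by (intro LIMSEQ_le_const) auto
  then have "prob (\<Inter>n. U n) = 1"
    using borel_0_1_law[OF indep] \<epsilon>(1) unfolding U_def by auto
  then have "AE x in M. x \<in> (\<Inter>n. U n)" using U by (subst (asm) prob_eq_1) auto
  then show ?thesis by eventually_elim (auto simp: U_def)
qed

lemma (in product_prob_space) measure_PiM_Collect:
  assumes "J \<subseteq> I" "finite J" "\<And>i. i \<in> J \<Longrightarrow> X i \<in> sets (M i)"
  shows "measure (PiM I M) {x \<in> space (PiM I M). \<forall>i\<in>J. x i \<in> X i} = (\<Prod>i\<in>J. measure (M i) (X i))"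
  using emeasure_PiM_Collect[OF assms]
  by (simp add: P.emeasure_eq_measure M.emeasure_eq_measure prod_ennreal prod_nonneg)

lemma (in product_prob_space) sets_PiM_Collect_finite:
  assumes "J \<subseteq> I" "finite J" "\<And>i. i \<in> J \<Longrightarrow> X i \<in> sets (M i)"
  shows "{x \<in> space (PiM I M). \<forall>i\<in>J. x i \<in> X i} \<in> sets (PiM I M)"
proof (rule sets.sets_Collect_finite_All[OF _ \<open>finite J\<close>])
  fix i assume "i \<in> J"
  then show "{x \<in> space (PiM I M). x i \<in> X i} \<in> sets (PiM I M)"
    using assms by (intro sets_Collect_single) auto
qed

text \<open>Every coordinate is constrained by at most one \<open>J n\<close>, so the constraints
  combine into a single family \<open>Y\<close>. A finite intersection is then again a cylinder, and
  its measure is a product that can be regrouped by \<open>n\<close>.\<close>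

lemma (in product_prob_space) indep_events_disjoint_cylinders:
  fixes J :: "nat \<Rightarrow> 'i set"
  assumes J: "\<And>n. J n \<subseteq> I" "\<And>n. finite (J n)" "disjoint_family J"
    and X: "\<And>n i. i \<in> J n \<Longrightarrow> X n i \<in> sets (M i)"
  shows "P.indep_events (\<lambda>n. {x \<in> space (PiM I M). \<forall>i\<in>J n. x i \<in> X n i}) UNIV"
proof (rule P.indep_eventsI)
  show "{x \<in> space (PiM I M). \<forall>i\<in>J n. x i \<in> X n i} \<in> P.events" for n
    by (intro sets_PiM_Collect_finite J X)
  fix K :: "nat set" assume K: "finite K" "K \<noteq> {}"
  define Y where "Y i = X (THE n. i \<in> J n) i" for i
  have Y: "Y i = X n i" if "i \<in> J n" for i n
  proof -
    have "(THE n. i \<in> J n) = n"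
      using that J(3) by (intro the_equality) (auto simp: disjoint_family_on_def)
    then show ?thesis by (simp add: Y_def)
  qed
  have "(\<Inter>n\<in>K. {x \<in> space (PiM I M). \<forall>i\<in>J n. x i \<in> X n i}) =
      {x \<in> space (PiM I M). \<forall>i\<in>(\<Union>n\<in>K. J n). x i \<in> Y i}"
    using K by (auto simp: Y)
  also have "P.prob \<dots> = (\<Prod>i\<in>(\<Union>n\<in>K. J n). measure (M i) (Y i))"
    using J K X by (intro measure_PiM_Collect) (auto simp: Y)
  also have "\<dots> = (\<Prod>n\<in>K. \<Prod>i\<in>J n. measure (M i) (Y i))"
    using J K by (intro prod.UNION_disjoint) (auto simp: disjoint_family_on_def)
  also have "\<dots> = (\<Prod>n\<in>K. P.prob {x \<in> space (PiM I M). \<forall>i\<in>J n. x i \<in> X n i})"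
    using J X by (intro prod.cong refl) (simp add: measure_PiM_Collect Y)
  finally show "P.prob (\<Inter>n\<in>K. {x \<in> space (PiM I M). \<forall>i\<in>J n. x i \<in> X n i}) =
      (\<Prod>n\<in>K. P.prob {x \<in> space (PiM I M). \<forall>i\<in>J n. x i \<in> X n i})" .
qed

section \<open>Probability of a fat cycle\<close>

text \<open>For cycles of length at most \<open>K\<close> only finitely many open intervals occur,
  all of positive measure, and the least of these measures serves as
  \<open>\<epsilon>\<close>.\<close>

lemma fat_range_measure:
  assumes \<nu>: "prob_space \<nu>" "sets \<nu> = sets (restrict_space borel {0..})"
      "support_is_positive_reals \<nu>"
    and L: "0 < L"
  obtains \<epsilon> where "0 < \<epsilon>" "\<epsilon> \<le> 1"
    "\<And>xs e. 3 \<le> length xs \<Longrightarrow> length xs \<le> K \<Longrightarrow>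
      fat_range L xs e \<in> sets \<nu> \<and> \<epsilon> \<le> measure \<nu> (fat_range L xs e)"
proof -
  interpret \<nu>: prob_space \<nu> by fact
  \<comment> \<open>The index \<open>k\<close> is the number \<open>length xs - 2\<close> of edges
    on the third side.\<close>
  define T where "T = {{2 * L <..< 3 * L}, {3 * L <..< 4 * L}} \<union>
    (\<lambda>k. {2 * L / real k <..< 3 * L / real k}) ` {1..K}"
  have T: "\<exists>a b. 0 \<le> a \<and> a < b \<and> A = {a <..< b}" if A: "A \<in> T" for A
  proof -
    consider "A = {2 * L <..< 3 * L}" | "A = {3 * L <..< 4 * L}"
      | k where "1 \<le> k" "A = {2 * L / real k <..< 3 * L / real k}"
      using A by (auto simp: T_def)
    then show ?thesis
    proof cases
      case 1
      then show ?thesis using L by (intro exI[of _ "2 * L"] exI[of _ "3 * L"]) auto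
    next
      case 2
      then show ?thesis using L by (intro exI[of _ "3 * L"] exI[of _ "4 * L"]) auto
    next
      case (3 k)
      then show ?thesis using L
        by (intro exI[of _ "2 * L / real k"] exI[of _ "3 * L / real k"])
           (auto simp: divide_strict_right_mono)
    qed
  qed
  have sets: "A \<in> sets \<nu>" if "A \<in> T" for A
    using T[OF that] by (auto simp: \<nu>(2) sets_restrict_space_iff)
  have pos: "0 < measure \<nu> A" if "A \<in> T" for A
    using T[OF that] \<nu>(3)
    by (auto simp: support_is_positive_reals_def \<nu>.emeasure_eq_measure)
  have fin: "finite (measure \<nu> ` T)" "measure \<nu> ` T \<noteq> {}" by (auto simp: T_def)
  show thesis
  proof (rule that[of "Min (measure \<nu> ` T)"])
    show "0 < Min (measure \<nu> ` T)" using fin pos by (subst Min_gr_iff) auto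
    show "Min (measure \<nu> ` T) \<le> 1"
      using fin by (subst Min_le_iff) auto
    fix xs :: "'a list" and e assume len: "3 \<le> length xs" "length xs \<le> K"
    have "fat_range L xs e \<in> T"
      using len unfolding fat_range_def T_def by (auto intro!: image_eqI[of _ _ "length xs - 2"])
    then show "fat_range L xs e \<in> sets \<nu> \<and> Min (measure \<nu> ` T) \<le> measure \<nu> (fat_range L xs e)"
      using sets fin(1) \<open>fat_range L xs e \<in> T\<close> by (intro conjI Min_le) auto
  qed
qed

lemma cycle_star_UN: "cycle_star E xs = (\<Union>v\<in>set xs. {e \<in> E. v \<in> e})"
  by (auto simp: cycle_star_def)

lemma finite_cycle_star:
  assumes "bounded_degree V E"
  obtains D where "\<And>xs. set xs \<subseteq> V \<Longrightarrow>
    finite (cycle_star E xs) \<and> card (cycle_star E xs) \<le> length xs * D"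
proof -
  obtain D where D: "\<And>v. v \<in> V \<Longrightarrow> finite {e \<in> E. v \<in> e} \<and> card {e \<in> E. v \<in> e} \<le> D"
    using assms by (auto simp: bounded_degree_def)
  show thesis
  proof (rule that[of D], intro conjI)
    fix xs assume xs: "set xs \<subseteq> V"
    then show "finite (cycle_star E xs)" using D by (auto simp: cycle_star_UN)
    have "card (cycle_star E xs) \<le> (\<Sum>v\<in>set xs. card {e \<in> E. v \<in> e})"
      unfolding cycle_star_UN by (rule card_UN_le) simp
    also have "\<dots> \<le> (\<Sum>v\<in>set xs. D)" using D xs by (intro sum_mono) auto
    also have "\<dots> \<le> length xs * D" by (simp add: card_length)
    finally show "card (cycle_star E xs) \<le> length xs * D" .
  qed
qed

text \<open>Greedy choice: each new cycle avoids all endpoints of the edges that meet an earlier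
  one, so no edge meets both.\<close>

lemma (in unit_graph) disjoint_short_cycles:
  assumes hyp: "gromov_hyperbolic X d" and deg: "bounded_degree V E"
    and not_tree: "\<And>B. bounded_vertex_set V E B \<Longrightarrow>
      \<exists>C \<in> graph_components (V - B) (induced_edges E (V - B)). \<not> is_tree C (induced_edges E C)"
  shows "\<exists>C K. (\<forall>n::nat. is_cycle V E (C n) \<and> length (C n) \<le> K) \<and>
    disjoint_family (\<lambda>n. cycle_star E (C n))"
proof -
  obtain K where K: "\<And>B. finite B \<Longrightarrow> B \<subseteq> V \<Longrightarrow>
      \<exists>xs. is_cycle V E xs \<and> length xs \<le> K \<and> set xs \<inter> B = {}"
    by (rule short_cycles_outside_finite[OF assms]) (assumption | blast intro: that)+
  then obtain f where f: "\<And>B. finite B \<Longrightarrow> B \<subseteq> V \<Longrightarrow>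
      is_cycle V E (f B) \<and> length (f B) \<le> K \<and> set (f B) \<inter> B = {}"
    by metis
  \<comment> \<open>\<open>Bs n\<close> collects the endpoints of all edges in the stars of the
    first \<open>n\<close> cycles.\<close>
  define Bs where "Bs = rec_nat {} (\<lambda>_ B. B \<union> \<Union>(cycle_star E (f B)))"
  have Bs0: "Bs 0 = {}" and BsSuc: "Bs (Suc n) = Bs n \<union> \<Union>(cycle_star E (f (Bs n)))" for n
    by (simp_all add: Bs_def)
  have Bs: "finite (Bs n) \<and> Bs n \<subseteq> V" for n
  proof (induction n)
    case (Suc n)
    then have "set (f (Bs n)) \<subseteq> V" using f by (auto simp: is_cycle_def)
    then have "finite (\<Union>(cycle_star E (f (Bs n))))"
    proof -
      have "\<Union>(cycle_star E (f (Bs n))) = (\<Union>v\<in>set (f (Bs n)). \<Union>{e \<in> E. v \<in> e})"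
        by (auto simp: cycle_star_def)
      with \<open>set (f (Bs n)) \<subseteq> V\<close> show ?thesis
        using finite_incident(2)[OF deg] by auto
    qed
    moreover have "\<Union>(cycle_star E (f (Bs n))) \<subseteq> V" by (auto simp: cycle_star_def elim!: edgeE)
    ultimately show ?case using Suc by (simp add: BsSuc)
  qed (simp add: Bs0)
  have mono: "Bs m \<subseteq> Bs n" if "m \<le> n" for m n
    using that by (rule lift_Suc_mono_le[rotated]) (auto simp: BsSuc)
  have disj: "cycle_star E (f (Bs m)) \<inter> cycle_star E (f (Bs n)) = {}" if "m < n" for m n
  proof -
    have "e \<subseteq> Bs n" if "e \<in> cycle_star E (f (Bs m))" for e
      using mono[of "Suc m" n] \<open>m < n\<close> that by (auto simp: BsSuc)
    moreover have "set (f (Bs n)) \<inter> Bs n = {}" using f Bs by blast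
    ultimately show ?thesis by (fastforce simp: cycle_star_def)
  qed
  show ?thesis
  proof (intro exI[of _ "\<lambda>n. f (Bs n)"] exI[of _ K] conjI allI)
    show "disjoint_family (\<lambda>n. cycle_star E (f (Bs n)))"
      unfolding disjoint_family_on_def using disj by (metis inf_commute linorder_neqE_nat)
  qed (use f Bs in auto)
qed

text \<open>Being fat constrains at most \<open>K * D\<close> independent weights, each with
  probability at least \<open>\<epsilon>\<close>. So \<open>\<epsilon> ^ (K * D)\<close> bounds the
  probability from below for all cycles at once, and disjoint stars give independence.\<close>

lemma AE_ex_fat_cycle:
  fixes \<nu> :: "real measure" and C :: "nat \<Rightarrow> 'a list"
  assumes \<nu>: "prob_space \<nu>" "sets \<nu> = sets (restrict_space borel {0..})"
      "support_is_positive_reals \<nu>"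
    and deg: "bounded_degree V E"
    and C: "\<And>n. is_cycle V E (C n)" "\<And>n. length (C n) \<le> K"
      "disjoint_family (\<lambda>n. cycle_star E (C n))"
    and L: "0 < L"
  shows "AE \<omega> in (\<Pi>\<^sub>M e\<in>E. \<nu>). \<exists>n. fat_cycle E \<omega> L (C n)"
    and "{\<omega> \<in> space (\<Pi>\<^sub>M e\<in>E. \<nu>). \<exists>n. fat_cycle E \<omega> L (C n)} \<in> sets (\<Pi>\<^sub>M e\<in>E. \<nu>)"
proof -
  interpret product_prob_space "\<lambda>_ :: 'a set. \<nu>" E using \<nu>(1) by (rule product_prob_spaceI)
  obtain \<epsilon> where \<epsilon>: "0 < \<epsilon>" "\<epsilon> \<le> 1"
    "\<And>(xs :: 'a list) e. 3 \<le> length xs \<Longrightarrow> length xs \<le> K \<Longrightarrow>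
      fat_range L xs e \<in> sets \<nu> \<and> \<epsilon> \<le> measure \<nu> (fat_range L xs e)"
    by (rule fat_range_measure[OF \<nu> L]) (blast intro: that)
  obtain D where D: "\<And>xs. set xs \<subseteq> V \<Longrightarrow>
    finite (cycle_star E xs) \<and> card (cycle_star E xs) \<le> length xs * D"
    by (rule finite_cycle_star[OF deg]) (blast intro: that)
  define J where "J n = cycle_star E (C n)" for n
  define A where "A n = {\<omega> \<in> space (\<Pi>\<^sub>M e\<in>E. \<nu>). \<forall>e\<in>J n. \<omega> e \<in> fat_range L (C n) e}" for n
  have len: "3 \<le> length (C n)" and CV: "set (C n) \<subseteq> V" for n
    using C(1) by (auto simp: is_cycle_def)
  have J: "J n \<subseteq> E" "finite (J n)" "card (J n) \<le> K * D" for n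
  proof -
    show "J n \<subseteq> E" "finite (J n)" using D[OF CV] by (auto simp: J_def cycle_star_def)
    have "card (J n) \<le> length (C n) * D" using D[OF CV] by (simp add: J_def)
    also have "\<dots> \<le> K * D" using C(2) by (intro mult_right_mono) auto
    finally show "card (J n) \<le> K * D" .
  qed
  have X: "fat_range L (C n) e \<in> sets \<nu>" "\<epsilon> \<le> measure \<nu> (fat_range L (C n) e)" for n e
    using \<epsilon>(3)[OF len C(2)] by auto
  have indep: "P.indep_events A UNIV"
    unfolding A_def using C(3) J X by (intro indep_events_disjoint_cylinders) (auto simp: J_def)
  have prob: "\<epsilon> ^ (K * D) \<le> P.prob (A n)" for n
  proof -
    have "\<epsilon> ^ (K * D) \<le> \<epsilon> ^ card (J n)" using J \<epsilon> by (intro power_decreasing) auto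
    also have "\<dots> = (\<Prod>e\<in>J n. \<epsilon>)" by simp
    also have "\<dots> \<le> (\<Prod>e\<in>J n. measure \<nu> (fat_range L (C n) e))"
      using X \<epsilon> by (intro prod_mono) auto
    also have "\<dots> = P.prob (A n)"
      unfolding A_def using J X by (intro measure_PiM_Collect[symmetric]) auto
    finally show ?thesis .
  qed
  have fat: "\<omega> \<in> A n \<longleftrightarrow> \<omega> \<in> space (\<Pi>\<^sub>M e\<in>E. \<nu>) \<and> fat_cycle E \<omega> L (C n)" for \<omega> n
    by (auto simp: A_def fat_cycle_def J_def)
  have "AE \<omega> in (\<Pi>\<^sub>M e\<in>E. \<nu>). \<exists>n. \<omega> \<in> A n"
    using P.indep_events_AE_ex[OF indep _ prob] \<epsilon>(1) by simp
  then show "AE \<omega> in (\<Pi>\<^sub>M e\<in>E. \<nu>). \<exists>n. fat_cycle E \<omega> L (C n)"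
    by eventually_elim (auto simp: fat)
  have "A n \<in> P.events" for n using indep by (auto simp: P.indep_events_def)
  then have "(\<Union>n. A n) \<in> P.events" by auto
  also have "(\<Union>n. A n) = {\<omega> \<in> space (\<Pi>\<^sub>M e\<in>E. \<nu>). \<exists>n. fat_cycle E \<omega> L (C n)}"
    by (auto simp: fat)
  finally show "{\<omega> \<in> space (\<Pi>\<^sub>M e\<in>E. \<nu>). \<exists>n. fat_cycle E \<omega> L (C n)} \<in> P.events" .
qed

theorem theorem1:
  fixes V :: "'a set" and E :: "'a set set" and \<nu> :: "real measure"
  assumes "simple_graph V E"
    and "infinite V"
    and "connected_graph V E"
    and "bounded_degree V E"
    and "gromov_hyperbolic (realization V E) (realization_dist V E (\<lambda>_. 1))"
    and "\<And>B. bounded_vertex_set V E B \<Longrightarrow>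
           \<exists>C \<in> graph_components (V - B) (induced_edges E (V - B)). \<not> is_tree C (induced_edges E C)"
    and "prob_space \<nu>"
    and "sets \<nu> = sets (restrict_space borel {0..})"
    and "integrable \<nu> (\<lambda>x. x)"
    and "support_is_positive_reals \<nu>"
    and "emeasure \<nu> {0} = 0"
  shows "\<exists>\<Omega>\<^sub>1 \<in> sets (\<Pi>\<^sub>M e\<in>E. \<nu>). emeasure (\<Pi>\<^sub>M e\<in>E. \<nu>) \<Omega>\<^sub>1 = 1 \<and>
           (\<forall>\<omega>\<in>\<Omega>\<^sub>1. \<not> gromov_hyperbolic (realization V E) (realization_dist V E \<omega>))"
proof -
  interpret G: unit_graph V E
    using assms(1,3) by unfold_locales auto
  have "\<exists>C K. (\<forall>n::nat. is_cycle V E (C n) \<and> length (C n) \<le> K) \<and>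
      disjoint_family (\<lambda>n. cycle_star E (C n))"
    by (rule G.disjoint_short_cycles[OF assms(5,4)]) (rule assms(6))
  then obtain C :: "nat \<Rightarrow> 'a list" and K
    where C: "\<And>n. is_cycle V E (C n)" "\<And>n. length (C n) \<le> K"
      "disjoint_family (\<lambda>n. cycle_star E (C n))"
    by blast
  interpret product_prob_space "\<lambda>_ :: 'a set. \<nu>" E using assms(7) by (rule product_prob_spaceI)
  note fat = AE_ex_fat_cycle[OF assms(7,8,10,4) C]
  \<comment> \<open>A countable intersection over all scales; \<open>Suc L\<close> keeps the scale
    positive.\<close>
  define \<Omega> where "\<Omega> = (\<Inter>L::nat. {\<omega> \<in> space (\<Pi>\<^sub>M e\<in>E. \<nu>). \<exists>n. fat_cycle E \<omega> (real (Suc L)) (C n)})"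
  have meas: "\<Omega> \<in> P.events" unfolding \<Omega>_def using fat(2) by (intro sets.countable_INT) auto
  have "AE \<omega> in (\<Pi>\<^sub>M e\<in>E. \<nu>). \<forall>L::nat. \<exists>n. fat_cycle E \<omega> (real (Suc L)) (C n)"
    unfolding AE_all_countable using fat(1) by auto
  then have "AE \<omega> in (\<Pi>\<^sub>M e\<in>E. \<nu>). \<omega> \<in> \<Omega>"
    using AE_space by eventually_elim (auto simp: \<Omega>_def)
  then have full: "emeasure (\<Pi>\<^sub>M e\<in>E. \<nu>) \<Omega> = 1" using meas by (intro P.emeasure_eq_1_AE)
  have "\<not> gromov_hyperbolic (realization V E) (realization_dist V E \<omega>)" if \<omega>: "\<omega> \<in> \<Omega>" for \<omega>
  proof
    have "space \<nu> = {0..}" using sets_eq_imp_space_eq[OF assms(8)] by (simp add: space_restrict_space)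
    moreover have "\<omega> \<in> space (\<Pi>\<^sub>M e\<in>E. \<nu>)" using \<omega> by (auto simp: \<Omega>_def)
    \<comment> \<open>Sampled weights are nonnegative everywhere, not just almost surely, because
      \<open>\<nu>\<close> lives on the space \<open>{0..}\<close>.\<close>
    ultimately have "\<omega> e \<in> {0..}" if "e \<in> E" for e using that by (auto simp: space_PiM)
    then interpret W: weighted_graph V E \<omega> using assms(1,3) by unfold_locales auto
    assume "gromov_hyperbolic (realization V E) (realization_dist V E \<omega>)"
    then obtain \<delta> where \<delta>: "delta_hyperbolic (realization V E) (realization_dist V E \<omega>) \<delta>"
      by (auto simp: gromov_hyperbolic_def)
    obtain L :: nat where "\<delta> \<le> real L" using real_arch_simple by blast
    then have L: "\<delta> \<le> real (Suc L)" by simp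
    obtain n where "fat_cycle E \<omega> (real (Suc L)) (C n)" using \<omega> by (auto simp: \<Omega>_def)
    from W.fat_cycle_not_hyperbolic[OF C(1) _ this L] \<delta> show False by simp
  qed
  with meas full show ?thesis by blast
qed

end
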